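(* Let $n\ge 1$ be an integer. The set $\mathcal{Y}_n=\{\chi_B : B\in\mathcal{B}_n\}$ is an orthogonal basis for $\mathcal{H}_n$ with respect to any exchangeable measure, and for every integer $0\le d\le n/2$ the set $\mathcal{Y}_{n,d}=\{\chi_B : B\in\mathcal{B}_{n,d}\}$ is an orthogonal basis for $\mathcal{H}'_{n,d}$ with respect to any exchangeable measure. That is, $\mathcal{Y}_n$ is a basis of the vector space $\mathcal{H}_n$, $\mathcal{Y}_{n,d}$ is a basis of the vector space $\mathcal{H}'_{n,d}$, and for every exchangeable measure $\mu$ and all distinct $B_1,B_2\in\mathcal{B}_n$ one has $\mathbb{E}_\mu[\chi_{B_1}\chi_{B_2}]=0$. In particular, the subspaces $\mathcal{H}'_{n,d}$ for different $d$ are mutually orthogonal with respect to any exchangeable measure.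
   Context: A polynomial $P\in\mathbb{R}[x_1,\dots,x_n]$ is multilinear if all its monomials are squarefree. A multilinear polynomial $P$ is harmonic if $\sum_{i=1}^n \partial P/\partial x_i=0$. $\mathcal{H}_n$ is the real vector space of harmonic multilinear polynomials in $x_1,\dots,x_n$, and $\mathcal{H}'_{n,d}$ is its subspace of polynomials all of whose monomials have degree exactly $d$ (including $0$). Write $[n]=\{1,\dots,n\}$. For an integer $0\le d\le n/2$, $\mathcal{S}_{n,d}$ is the set of sequences $S=s_1,\dots,s_d$ of distinct elements of $[n]$. For disjoint $A,B\in\mathcal{S}_{n,d}$ (no common elements), let $\chi_{A,B}=\prod_{i=1}^d (x_{a_i}-x_{b_i})$, and write $A<B$ if $a_i<b_i$ for all $i\in[d]$ (the relation $A<B$ is only used for disjoint $A,B$; $A$ need not be increasing). A top set of length $d$ is an increasing sequence $B\in\mathcal{S}_{n,d}$ for which there exists a sequence $A\in\mathcal{S}_{n,d}$ disjoint from $B$ with $A<B$. $\mathcal{B}_{n,d}$ is the set of top sets of length $d$, and $\mathcal{B}_n=\bigcup_{0\le d\le n/2}\mathcal{B}_{n,d}$. For $B\in\mathcal{B}_{n,d}$, define $$\chi_B=\sum_{A\in\mathcal{S}_{n,d}:\ A\cap B=\emptyset,\ A<B}\chi_{A,B}$$ (so $\chi_\emptyset=1$). An exchangeable measure is a probability distribution $\mu$ of $(x_1,\dots,x_n)\in\mathbb{R}^n$ that is invariant under permutations of the indices; it is assumed that $\mathbb{E}_\mu|fg|<\infty$ for all $f,g\in\mathcal{H}_n$, and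 one puts $\langle f,g\rangle=\mathbb{E}_\mu[fg]$. (This form may be degenerate; orthogonality of $f$ and $g$ just means $\langle f,g\rangle=0$.) *)

theory Defs
  imports "HOL-Probability.Probability" "HOL-Analysis.Finite_Function_Topology"
begin

text \<open>
  Real polynomials in variables indexed by \<^typ>\<open>nat\<close>: finitely supported maps from exponent
  vectors to coefficients. The ring and real vector space structures are the library's.
\<close>

type_synonym mono = "nat \<Rightarrow>\<^sub>0 nat"
type_synonym rpoly = "mono \<Rightarrow>\<^sub>0 real"

definition PVar :: "nat \<Rightarrow> rpoly" where
  "PVar i = Poly_Mapping.single (Poly_Mapping.single i 1) 1"

definition peval :: "rpoly \<Rightarrow> (nat \<Rightarrow> real) \<Rightarrow> real" where
  "peval P x = (\<Sum>m\<in>Poly_Mapping.keys P. Poly_Mapping.lookup P m *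
     (\<Prod>i\<in>Poly_Mapping.keys m. x i ^ Poly_Mapping.lookup m i))"

text \<open>
  When \<open>x\<^sub>i\<close> does not occur in a monomial the truncated subtraction below is harmless,
  because the coefficient is then \<open>0\<close>.
\<close>

definition partial_deriv :: "nat \<Rightarrow> rpoly \<Rightarrow> rpoly" where
  "partial_deriv i P = (\<Sum>m\<in>Poly_Mapping.keys P.
     Poly_Mapping.single (m - Poly_Mapping.single i 1)
       (real (Poly_Mapping.lookup m i) * Poly_Mapping.lookup P m))"

definition mono_degree :: "mono \<Rightarrow> nat" where
  "mono_degree m = (\<Sum>i\<in>Poly_Mapping.keys m. Poly_Mapping.lookup m i)"

definition polys_in :: "nat \<Rightarrow> rpoly set" where
  "polys_in n = {P. \<forall>m\<in>Poly_Mapping.keys P. Poly_Mapping.keys m \<subseteq> {1..n}}"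

definition multilinear :: "rpoly \<Rightarrow> bool" where
  "multilinear P \<longleftrightarrow> (\<forall>m\<in>Poly_Mapping.keys P. \<forall>i. Poly_Mapping.lookup m i \<le> 1)"

definition harmonic :: "nat \<Rightarrow> rpoly \<Rightarrow> bool" where
  "harmonic n P \<longleftrightarrow> (\<Sum>i=1..n. partial_deriv i P) = 0"

definition Harm :: "nat \<Rightarrow> rpoly set" where
  "Harm n = {P \<in> polys_in n. multilinear P \<and> harmonic n P}"

definition Harm_hom :: "nat \<Rightarrow> nat \<Rightarrow> rpoly set" where
  "Harm_hom n d = {P \<in> Harm n. \<forall>m\<in>Poly_Mapping.keys P. mono_degree m = d}"

definition Seqs :: "nat \<Rightarrow> nat \<Rightarrow> nat list set" where
  "Seqs n d = {S. length S = d \<and> distinct S \<and> set S \<subseteq> {1..n}}"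

definition disjoint_seqs :: "nat list \<Rightarrow> nat list \<Rightarrow> bool" where
  "disjoint_seqs A B \<longleftrightarrow> set A \<inter> set B = {}"

definition seq_less :: "nat list \<Rightarrow> nat list \<Rightarrow> bool" where
  "seq_less A B \<longleftrightarrow> list_all2 (<) A B"

definition chi_pair :: "nat list \<Rightarrow> nat list \<Rightarrow> rpoly" where
  "chi_pair A B = (\<Prod>i<length B. PVar (A ! i) - PVar (B ! i))"

definition Top_sets_len :: "nat \<Rightarrow> nat \<Rightarrow> nat list set" where
  "Top_sets_len n d =
     {B \<in> Seqs n d. sorted_wrt (<) B \<and> (\<exists>A\<in>Seqs n d. disjoint_seqs A B \<and> seq_less A B)}"

definition Top_sets :: "nat \<Rightarrow> nat list set" where
  "Top_sets n = (\<Union>d\<in>{d. 2 * d \<le> n}. Top_sets_len n d)"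

definition chi :: "nat \<Rightarrow> nat list \<Rightarrow> rpoly" where
  "chi n B = (\<Sum>A\<in>{A \<in> Seqs n (length B). disjoint_seqs A B \<and> seq_less A B}. chi_pair A B)"

text \<open>
  Points of \<open>\<real>\<^sup>n\<close> are the extensional functions on \<open>{1..n}\<close>, with the product Borel sigma-algebra.
\<close>

definition exchangeable_measure :: "nat \<Rightarrow> (nat \<Rightarrow> real) measure \<Rightarrow> bool" where
  "exchangeable_measure n \<mu> \<longleftrightarrow>
     prob_space \<mu> \<and>
     sets \<mu> = sets (Pi\<^sub>M {1..n} (\<lambda>_. borel)) \<and>
     (\<forall>\<pi>. \<pi> permutes {1..n} \<longrightarrow>
        distr \<mu> (Pi\<^sub>M {1..n} (\<lambda>_. borel)) (\<lambda>x. \<lambda>i\<in>{1..n}. x (\<pi> i)) = \<mu>) \<and>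
     (\<forall>f\<in>Harm n. \<forall>g\<in>Harm n. integrable \<mu> (\<lambda>x. peval f x * peval g x))"

definition poly_inner :: "(nat \<Rightarrow> real) measure \<Rightarrow> rpoly \<Rightarrow> rpoly \<Rightarrow> real" where
  "poly_inner \<mu> f g = (LINT x|\<mu>. peval f x * peval g x)"

end

theory Submission
  imports Defs
begin

text \<open>
  The operators \<open>f \<mapsto> \<Sum>i,j\<le>m. (f - f \<circ> (i j))\<close> for \<open>m \<le> n\<close> are self-adjoint with respect to every
  exchangeable measure. Each \<open>\<chi>\<^sub>B\<close> is an eigenvector of all of them: with \<open>k = |B \<inter> [m]|\<close> the
  eigenvalue is \<open>2k(m + 1 - k)\<close>. A top set satisfies \<open>2k \<le> m\<close>, hence the eigenvalues determine all
  the numbers \<open>|B \<inter> [m]|\<close> and therefore \<open>B\<close>. This gives orthogonality; applied to the counting measure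
  on the cube \<open>{0,1}\<^sup>n\<close>, where no \<open>\<chi>\<^sub>B\<close> vanishes identically, it also gives linear independence.

  For the spanning property it suffices that a harmonic \<open>P\<close> whose coefficients at all top sets vanish
  is zero. If \<open>P \<noteq> 0\<close>, let \<open>S\<close> be its largest monomial in colexicographic order and suppose that
  \<open>|S \<inter> [m]| > m/2\<close>. The terms of \<open>P\<close> that agree with \<open>S\<close> beyond \<open>m\<close> then provide a harmonic form in \<open>m\<close>
  variables of degree larger than \<open>m/2\<close>, and such a form is zero. So \<open>S\<close> satisfies the ballot condition,
  which makes it a top set.
\<close>

section \<open>Evaluation and differentiation of polynomials\<close>

lemma sum_single_keys:
  "(\<Sum>m\<in>Poly_Mapping.keys P. Poly_Mapping.single m (Poly_Mapping.lookup P m)) = P"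
  by (rule poly_mapping_eqI) (auto simp: lookup_sum lookup_single when_def in_keys_iff)

text \<open>A polynomial is the finite sum of its terms, so additive statements need only be checked
  on single terms. This reduces the product rules for \<open>peval\<close> and
  \<open>partial_deriv\<close> to monomials.\<close>

lemma poly_mapping_single_add_induct [case_names single add]:
  fixes P :: "'a \<Rightarrow>\<^sub>0 'b::comm_monoid_add"
  assumes "\<And>m c. Q (Poly_Mapping.single m c)" and "\<And>P R. Q P \<Longrightarrow> Q R \<Longrightarrow> Q (P + R)"
  shows "Q P"
proof -
  have "Q (\<Sum>m\<in>K. Poly_Mapping.single m (Poly_Mapping.lookup P m))" if "finite K" for K
    using that
  proof induction
    case empty
    \<comment> \<open>The empty sum is a single term with coefficient 0, at an arbitrary
      exponent.\<close>
    show ?case using assms(1)[of undefined 0] by simp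
  qed (simp add: assms)
  then show ?thesis by (metis finite_keys sum_single_keys)
qed

lemma lookup_scaleR [simp]:
  fixes P :: "'a \<Rightarrow>\<^sub>0 real"
  shows "Poly_Mapping.lookup (c *\<^sub>R P) m = c * Poly_Mapping.lookup P m"
proof -
  have "finite {i. c *\<^sub>R Poly_Mapping.lookup P i \<noteq> 0}"
    by (rule finite_subset[of _ "Poly_Mapping.keys P"]) (auto simp: in_keys_iff)
  then show ?thesis by (simp add: scaleR_poly_mapping_def)
qed

lemma keys_scaleR_subset:
  fixes P :: "'a \<Rightarrow>\<^sub>0 real"
  shows "Poly_Mapping.keys (c *\<^sub>R P) \<subseteq> Poly_Mapping.keys P"
  by (auto simp: in_keys_iff)

definition mono_eval :: "mono \<Rightarrow> (nat \<Rightarrow> real) \<Rightarrow> real" where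
  "mono_eval m x = (\<Prod>i\<in>Poly_Mapping.keys m. x i ^ Poly_Mapping.lookup m i)"

lemma mono_eval_superset:
  assumes "finite K" "Poly_Mapping.keys m \<subseteq> K"
  shows "mono_eval m x = (\<Prod>i\<in>K. x i ^ Poly_Mapping.lookup m i)"
  unfolding mono_eval_def
  by (rule prod.mono_neutral_left) (use assms in \<open>auto simp: in_keys_iff\<close>)

lemma mono_eval_add: "mono_eval (m + k) x = mono_eval m x * mono_eval k x"
proof -
  let ?K = "Poly_Mapping.keys m \<union> Poly_Mapping.keys k"
  have "mono_eval (m + k) x = (\<Prod>i\<in>?K. x i ^ Poly_Mapping.lookup (m + k) i)"
    by (rule mono_eval_superset) (use keys_add[of m k] in auto)
  also have "\<dots> = (\<Prod>i\<in>?K. x i ^ Poly_Mapping.lookup m i) * (\<Prod>i\<in>?K. x i ^ Poly_Mapping.lookup k i)"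
    by (simp add: lookup_add power_add prod.distrib)
  also have "\<dots> = mono_eval m x * mono_eval k x"
    by (simp add: mono_eval_superset[of ?K m] mono_eval_superset[of ?K k])
  finally show ?thesis .
qed

lemma peval_superset:
  assumes "finite K" "Poly_Mapping.keys P \<subseteq> K"
  shows "peval P x = (\<Sum>m\<in>K. Poly_Mapping.lookup P m * mono_eval m x)"
  unfolding peval_def mono_eval_def
  by (rule sum.mono_neutral_left) (use assms in \<open>auto simp: in_keys_iff\<close>)

lemma peval_zero [simp]: "peval 0 x = 0"
  by (simp add: peval_def)

lemma peval_single [simp]: "peval (Poly_Mapping.single m c) x = c * mono_eval m x"
  by (subst peval_superset[of "{m}"]) auto

lemma peval_add [simp]: "peval (P + Q) x = peval P x + peval Q x"
proof -
  let ?K = "Poly_Mapping.keys P \<union> Poly_Mapping.keys Q"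
  have "Poly_Mapping.keys (P + Q) \<subseteq> ?K" by (rule keys_add)
  then show ?thesis
    by (simp add: peval_superset[of ?K] lookup_add distrib_right sum.distrib)
qed

lemma peval_scaleR [simp]: "peval (c *\<^sub>R P) x = c * peval P x"
proof -
  have "peval (c *\<^sub>R P) x = (\<Sum>m\<in>Poly_Mapping.keys P. Poly_Mapping.lookup (c *\<^sub>R P) m * mono_eval m x)"
    by (intro peval_superset keys_scaleR_subset finite_keys)
  also have "\<dots> = c * peval P x"
    by (subst peval_superset[OF finite_keys subset_refl]) (simp add: sum_distrib_left mult.assoc)
  finally show ?thesis .
qed

lemma peval_diff [simp]: "peval (P - Q) x = peval P x - peval Q x"
  using peval_add[of "P - Q" Q x] by simp

lemma peval_sum [simp]: "peval (sum f A) x = (\<Sum>a\<in>A. peval (f a) x)"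
  by (induction A rule: infinite_finite_induct) auto

lemma peval_mult [simp]: "peval (P * Q) x = peval P x * peval Q x"
proof (induction P rule: poly_mapping_single_add_induct)
  case (single m c)
  show ?case
    by (induction Q rule: poly_mapping_single_add_induct)
      (auto simp: mult_single mono_eval_add distrib_left)
qed (simp add: distrib_right)

lemma peval_one [simp]: "peval 1 x = 1"
  by (simp add: single_one[symmetric] mono_eval_def del: single_one)

lemma peval_prod [simp]: "peval (prod f A) x = (\<Prod>a\<in>A. peval (f a) x)"
  by (induction A rule: infinite_finite_induct) auto

lemma peval_PVar [simp]: "peval (PVar i) x = x i"
  by (simp add: PVar_def mono_eval_def)

section \<open>Partial derivatives and harmonicity\<close>

lemma lookup_partial_deriv:
  "Poly_Mapping.lookup (partial_deriv i P) m =
    (real (Poly_Mapping.lookup m i) + 1) * Poly_Mapping.lookup P (m + Poly_Mapping.single i 1)"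
proof -
  let ?e = "Poly_Mapping.single i 1 :: mono"
  \<comment> \<open>Truncated subtraction of \<open>?e\<close> is injective only on exponent vectors
    with a positive entry at \<open>i\<close>; the other \<open>m'\<close> enter with the factor
    0.\<close>
  have eq: "(m' - ?e = m \<and> Poly_Mapping.lookup m' i \<noteq> 0) \<longleftrightarrow> m' = m + ?e" for m'
    by (auto simp: poly_mapping_eq_iff fun_eq_iff lookup_add lookup_minus lookup_single when_def)
  have "Poly_Mapping.lookup (partial_deriv i P) m =
      (\<Sum>m'\<in>Poly_Mapping.keys P. if m' = m + ?e
        then (real (Poly_Mapping.lookup m i) + 1) * Poly_Mapping.lookup P (m + ?e) else 0)"
    unfolding partial_deriv_def lookup_sum
  proof (rule sum.cong[OF refl])
    fix m' assume "m' \<in> Poly_Mapping.keys P"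
    show "Poly_Mapping.lookup (Poly_Mapping.single (m' - ?e)
          (real (Poly_Mapping.lookup m' i) * Poly_Mapping.lookup P m')) m =
        (if m' = m + ?e then (real (Poly_Mapping.lookup m i) + 1) * Poly_Mapping.lookup P (m + ?e) else 0)"
      using eq[of m'] by (auto simp: lookup_single lookup_add when_def)
  qed
  also have "\<dots> = (real (Poly_Mapping.lookup m i) + 1) * Poly_Mapping.lookup P (m + ?e)"
    by (auto simp: in_keys_iff)
  finally show ?thesis .
qed

lemma partial_deriv_add: "partial_deriv i (P + Q) = partial_deriv i P + partial_deriv i Q"
  by (rule poly_mapping_eqI) (simp add: lookup_partial_deriv lookup_add algebra_simps)

lemma partial_deriv_diff: "partial_deriv i (P - Q) = partial_deriv i P - partial_deriv i Q"
  by (rule poly_mapping_eqI) (simp add: lookup_partial_deriv lookup_minus algebra_simps)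

lemma partial_deriv_scaleR: "partial_deriv i (c *\<^sub>R P) = c *\<^sub>R partial_deriv i P"
  by (rule poly_mapping_eqI) (simp add: lookup_partial_deriv)

lemma partial_deriv_single:
  "partial_deriv i (Poly_Mapping.single m c) =
    Poly_Mapping.single (m - Poly_Mapping.single i 1) (real (Poly_Mapping.lookup m i) * c)"
  by (auto simp: partial_deriv_def)

lemma partial_deriv_mult:
  "partial_deriv i (P * Q) = partial_deriv i P * Q + P * partial_deriv i Q"
proof (induction P rule: poly_mapping_single_add_induct)
  case (single m c)
  show ?case
  proof (induction Q rule: poly_mapping_single_add_induct)
    case (single k d)
    let ?e = "Poly_Mapping.single i 1 :: mono"
    \<comment> \<open>Subtracting \<open>?e\<close> from the sum may be moved to a summand only if
      \<open>i\<close> occurs in it; otherwise the corresponding term of the product rule is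
      0.\<close>
    have 1: "m + k - ?e = m - ?e + k" if "Poly_Mapping.lookup m i \<noteq> 0"
      using that by (intro poly_mapping_eqI) (auto simp: lookup_add lookup_minus lookup_single when_def)
    have 2: "m + k - ?e = m + (k - ?e)" if "Poly_Mapping.lookup k i \<noteq> 0"
      using that by (intro poly_mapping_eqI) (auto simp: lookup_add lookup_minus lookup_single when_def)
    have "partial_deriv i (Poly_Mapping.single m c * Poly_Mapping.single k d) =
      Poly_Mapping.single (m + k - ?e) (real (Poly_Mapping.lookup m i) * (c * d)) +
      Poly_Mapping.single (m + k - ?e) (real (Poly_Mapping.lookup k i) * (c * d))"
      by (simp add: mult_single partial_deriv_single lookup_add distrib_right single_add)
    also have "Poly_Mapping.single (m + k - ?e) (real (Poly_Mapping.lookup m i) * (c * d)) =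
        partial_deriv i (Poly_Mapping.single m c) * Poly_Mapping.single k d"
      using 1 by (cases "Poly_Mapping.lookup m i = 0") (auto simp: mult_single partial_deriv_single mult.assoc)
    also have "Poly_Mapping.single (m + k - ?e) (real (Poly_Mapping.lookup k i) * (c * d)) =
        Poly_Mapping.single m c * partial_deriv i (Poly_Mapping.single k d)"
      using 2 by (cases "Poly_Mapping.lookup k i = 0") (auto simp: mult_single partial_deriv_single mult.left_commute)
    finally show ?case .
  qed (simp add: distrib_left partial_deriv_add algebra_simps)
qed (simp add: distrib_right partial_deriv_add algebra_simps)

lemma partial_deriv_PVar: "partial_deriv i (PVar j) = (if i = j then 1 else 0)"
  by (auto simp: PVar_def partial_deriv_single lookup_single when_def)

text \<open>The sum of all partial derivatives is a derivation, so its kernel is closed under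
  products.\<close>

lemma harmonic_mult:
  assumes "harmonic n P" "harmonic n Q"
  shows "harmonic n (P * Q)"
proof -
  have "(\<Sum>i=1..n. partial_deriv i (P * Q)) =
      (\<Sum>i=1..n. partial_deriv i P) * Q + P * (\<Sum>i=1..n. partial_deriv i Q)"
    by (simp add: partial_deriv_mult sum.distrib sum_distrib_left sum_distrib_right)
  then show ?thesis using assms by (simp add: harmonic_def)
qed

lemma harmonic_one: "harmonic n 1"
  by (simp add: harmonic_def single_one[symmetric] partial_deriv_single del: single_one)

lemma harmonic_prod:
  assumes "\<And>i. i \<in> I \<Longrightarrow> harmonic n (f i)"
  shows "harmonic n (prod f I)"
  using assms by (induction I rule: infinite_finite_induct) (auto simp: harmonic_one harmonic_mult)

lemma harmonic_PVar_diff: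
  assumes "a \<in> {1..n}" "b \<in> {1..n}"
  shows "harmonic n (PVar a - PVar b)"
  using assms by (simp add: harmonic_def partial_deriv_diff partial_deriv_PVar sum_subtractf)

section \<open>The spaces of harmonic polynomials\<close>

lemma subspace_Harm: "subspace (Harm n)"
  unfolding subspace_def
proof (intro conjI ballI allI)
  show "0 \<in> Harm n"
    by (simp add: Harm_def polys_in_def multilinear_def harmonic_def partial_deriv_def)
next
  fix P Q assume "P \<in> Harm n" "Q \<in> Harm n"
  then show "P + Q \<in> Harm n"
    using keys_add[of P Q]
    by (auto simp: Harm_def polys_in_def multilinear_def harmonic_def partial_deriv_add sum.distrib)
next
  fix P and c :: real assume "P \<in> Harm n"
  then show "c *\<^sub>R P \<in> Harm n"
    using keys_scaleR_subset[of c P]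
    by (auto simp: Harm_def polys_in_def multilinear_def harmonic_def partial_deriv_scaleR
        scaleR_sum_right[symmetric])
qed

lemma subspace_Harm_hom: "subspace (Harm_hom n d)"
proof -
  have "subspace {P :: rpoly. \<forall>m\<in>Poly_Mapping.keys P. mono_degree m = d}"
    unfolding subspace_def using keys_add keys_scaleR_subset by fastforce
  then have "subspace (Harm n \<inter> {P. \<forall>m\<in>Poly_Mapping.keys P. mono_degree m = d})"
    by (rule subspace_inter[OF subspace_Harm])
  also have "\<dots> = Harm_hom n d" by (auto simp: Harm_hom_def)
  finally show ?thesis .
qed

lemma mono_degree_superset:
  assumes "finite K" "Poly_Mapping.keys m \<subseteq> K"
  shows "mono_degree m = (\<Sum>i\<in>K. Poly_Mapping.lookup m i)"
  unfolding mono_degree_def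
  by (rule sum.mono_neutral_left) (use assms in \<open>auto simp: in_keys_iff\<close>)

lemma mono_degree_add: "mono_degree (m + k) = mono_degree m + mono_degree k"
proof -
  let ?K = "Poly_Mapping.keys m \<union> Poly_Mapping.keys k"
  have "mono_degree (m + k) = (\<Sum>i\<in>?K. Poly_Mapping.lookup (m + k) i)"
    by (rule mono_degree_superset) (use keys_add[of m k] in auto)
  then show ?thesis
    by (simp add: mono_degree_superset[of ?K m] mono_degree_superset[of ?K k] lookup_add sum.distrib)
qed

text \<open>Expanding the product picks one of the two indices from each factor. Injectivity and
  disjointness make the picked indices distinct, so the resulting monomial is squarefree with one
  variable per factor.\<close>

lemma keys_prod_PVar_diff:
  assumes "finite I" "inj_on a I" "inj_on b I" "a ` I \<inter> b ` I = {}"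
    and "m \<in> Poly_Mapping.keys (\<Prod>i\<in>I. PVar (a i) - PVar (b i))"
  shows "Poly_Mapping.keys m \<subseteq> a ` I \<union> b ` I \<and> (\<forall>j. Poly_Mapping.lookup m j \<le> 1) \<and> mono_degree m = card I"
  using assms
proof (induction I arbitrary: m rule: finite_induct)
  case empty
  then show ?case by (simp add: mono_degree_def)
next
  case (insert i I)
  have "m \<in> Poly_Mapping.keys ((PVar (a i) - PVar (b i)) * (\<Prod>i\<in>I. PVar (a i) - PVar (b i)))"
    using insert by simp
  then obtain k l where m: "m = k + l" and k: "k \<in> Poly_Mapping.keys (PVar (a i) - PVar (b i))"
      and l: "l \<in> Poly_Mapping.keys (\<Prod>i\<in>I. PVar (a i) - PVar (b i))"
    using keys_mult by blast
  have "k = Poly_Mapping.single (a i) 1 \<or> k = Poly_Mapping.single (b i) 1"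
    using k by (auto simp: in_keys_iff lookup_minus PVar_def lookup_single when_def split: if_splits)
  then obtain c where c: "c = a i \<or> c = b i" and kc: "k = Poly_Mapping.single c 1" by blast
  have IH: "Poly_Mapping.keys l \<subseteq> a ` I \<union> b ` I" "\<forall>j. Poly_Mapping.lookup l j \<le> 1" "mono_degree l = card I"
    using insert.IH[OF _ _ _ l] insert.prems by auto
  have "c \<notin> a ` I \<union> b ` I"
    using insert.prems insert.hyps c by (auto simp: inj_on_def)
  then have 0: "Poly_Mapping.lookup l c = 0" using IH(1) by (meson in_keys_iff subsetD)
  have "Poly_Mapping.lookup m j \<le> 1" for j
    using IH(2) 0 by (auto simp: m kc lookup_add lookup_single when_def)
  moreover have "Poly_Mapping.keys m \<subseteq> a ` insert i I \<union> b ` insert i I"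
    using keys_add[of k l] IH(1) c by (auto simp: m kc)
  moreover have "mono_degree m = card (insert i I)"
    using insert.hyps IH(3) by (simp add: m mono_degree_add kc) (simp add: mono_degree_def)
  ultimately show ?case by blast
qed

lemma chi_pair_in_Harm_hom:
  assumes "A \<in> Seqs n d" "B \<in> Seqs n d" "disjoint_seqs A B"
  shows "chi_pair A B \<in> Harm_hom n d"
proof -
  have len: "length A = d" "length B = d" and AB: "distinct A" "distinct B" "set A \<inter> set B = {}"
    and sub: "set A \<subseteq> {1..n}" "set B \<subseteq> {1..n}"
    using assms by (auto simp: Seqs_def disjoint_seqs_def)
  have im: "(!) A ` {..<d} = set A" "(!) B ` {..<d} = set B"
    using len by (auto simp: set_conv_nth)
  have "Poly_Mapping.keys m \<subseteq> set A \<union> set B \<and> (\<forall>j. Poly_Mapping.lookup m j \<le> 1) \<and> mono_degree m = d"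
    if "m \<in> Poly_Mapping.keys (chi_pair A B)" for m
    using keys_prod_PVar_diff[of "{..<d}" "(!) A" "(!) B" m] that len AB
    by (simp add: chi_pair_def im inj_on_nth)
  moreover have "A ! i \<in> {1..n}" "B ! i \<in> {1..n}" if "i < d" for i
    using that len subsetD[OF sub(1) nth_mem] subsetD[OF sub(2) nth_mem] by simp_all
  then have "harmonic n (chi_pair A B)"
    unfolding chi_pair_def len by (intro harmonic_prod harmonic_PVar_diff) auto
  ultimately show ?thesis
    using sub by (fastforce simp: Harm_hom_def Harm_def polys_in_def multilinear_def)
qed

lemma chi_in_Harm_hom:
  assumes "B \<in> Seqs n d"
  shows "chi n B \<in> Harm_hom n d"
  unfolding chi_def
  by (rule subspace_sum[OF subspace_Harm_hom])
    (use assms in \<open>auto intro!: chi_pair_in_Harm_hom simp: Seqs_def\<close>)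

lemma peval_chi:
  "peval (chi n B) x = (\<Sum>A\<in>{A \<in> Seqs n (length B). disjoint_seqs A B \<and> seq_less A B}.
     \<Prod>i<length B. x (A ! i) - x (B ! i))"
  by (simp add: chi_def chi_pair_def)

section \<open>Sums over transpositions\<close>

text \<open>This retains what the Garnir relation uses of a multilinear polynomial in the variables
  of \<open>S\<close>. It is stated for functions, on which transpositions act by
  composition.\<close>

definition multi_affine :: "nat set \<Rightarrow> ((nat \<Rightarrow> real) \<Rightarrow> real) \<Rightarrow> bool" where
  "multi_affine S f \<longleftrightarrow> (\<forall>x y. (\<forall>i\<in>S. x i = y i) \<longrightarrow> f x = f y) \<and>
     (\<forall>x j. \<exists>p q. \<forall>t. f (x(j := t)) = p + q * t)"

lemma multi_affineD: "multi_affine S f \<Longrightarrow> (\<And>i. i \<in> S \<Longrightarrow> x i = y i) \<Longrightarrow> f x = f y"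
  unfolding multi_affine_def by blast

lemma multi_affine_upd: "multi_affine S f \<Longrightarrow> j \<notin> S \<Longrightarrow> f (x(j := t)) = f x"
  by (rule multi_affineD) auto

lemma multi_affine_mono: "multi_affine S f \<Longrightarrow> S \<subseteq> T \<Longrightarrow> multi_affine T f"
  unfolding multi_affine_def by blast

lemma multi_affine_const: "multi_affine S (\<lambda>x. c)"
  unfolding multi_affine_def by (intro conjI allI impI exI[of _ c] exI[of _ 0]) auto

lemma multi_affine_add:
  assumes "multi_affine S f" "multi_affine S g"
  shows "multi_affine S (\<lambda>x. f x + g x)"
  unfolding multi_affine_def
proof (intro conjI allI impI)
  fix x y :: "nat \<Rightarrow> real" assume "\<forall>i\<in>S. x i = y i"
  then show "f x + g x = f y + g y"
    using multi_affineD[OF assms(1), of x y] multi_affineD[OF assms(2), of x y] by simp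
next
  fix x :: "nat \<Rightarrow> real" and j
  obtain p q p' q' where "\<And>t. f (x(j := t)) = p + q * t" "\<And>t. g (x(j := t)) = p' + q' * t"
    using assms unfolding multi_affine_def by metis
  then have "\<forall>t. f (x(j := t)) + g (x(j := t)) = (p + p') + (q + q') * t"
    by (simp add: algebra_simps)
  then show "\<exists>p q. \<forall>t. f (x(j := t)) + g (x(j := t)) = p + q * t" by blast
qed

lemma multi_affine_sum:
  assumes "\<And>a. a \<in> A \<Longrightarrow> multi_affine S (f a)"
  shows "multi_affine S (\<lambda>x. \<Sum>a\<in>A. f a x)"
  using assms by (induction A rule: infinite_finite_induct) (auto intro: multi_affine_const multi_affine_add)

text \<open>With disjoint supports, changing one coordinate affects at most one of the
  factors.\<close>

lemma multi_affine_mult: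
  assumes f: "multi_affine S f" and g: "multi_affine T g" and "S \<inter> T = {}"
  shows "multi_affine (S \<union> T) (\<lambda>x. f x * g x)"
  unfolding multi_affine_def
proof (intro conjI allI impI)
  fix x y :: "nat \<Rightarrow> real" assume "\<forall>i\<in>S \<union> T. x i = y i"
  then show "f x * g x = f y * g y"
    using multi_affineD[OF f, of x y] multi_affineD[OF g, of x y] by simp
next
  fix x :: "nat \<Rightarrow> real" and j
  obtain p q p' q' where pq: "\<And>t. f (x(j := t)) = p + q * t" "\<And>t. g (x(j := t)) = p' + q' * t"
    using assms unfolding multi_affine_def by metis
  show "\<exists>p q. \<forall>t. f (x(j := t)) * g (x(j := t)) = p + q * t"
  proof (cases "j \<in> S")
    case True
    then have "j \<notin> T" using assms by blast
    then have "\<forall>t. f (x(j := t)) * g (x(j := t)) = p * g x + (q * g x) * t"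
      using multi_affine_upd[OF g] pq(1) by (simp add: algebra_simps)
    then show ?thesis by blast
  next
    case False
    then have "\<forall>t. f (x(j := t)) * g (x(j := t)) = f x * p' + (f x * q') * t"
      using multi_affine_upd[OF f] pq(2) by (simp add: algebra_simps)
    then show ?thesis by blast
  qed
qed

lemma multi_affine_coord: "multi_affine {a} (\<lambda>x. c * x a)"
  unfolding multi_affine_def
proof (intro conjI allI impI)
  fix x :: "nat \<Rightarrow> real" and j
  show "\<exists>p q. \<forall>t. c * (x(j := t)) a = p + q * t"
    by (cases "j = a") (auto intro: exI[of _ 0] exI[of _ "c * x a"])
qed simp

lemma multi_affine_diff: "multi_affine {a, b} (\<lambda>x. x a - x b)"
  using multi_affine_add[OF multi_affine_mono[OF multi_affine_coord[of a 1], of "{a, b}"]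
      multi_affine_mono[OF multi_affine_coord[of b "-1"], of "{a, b}"]] by simp

text \<open>The conditions on \<open>M\<close> say that its pairs form a matching: no index occurs
  in two pairs or twice in one. In this form the already chosen pairs \<open>(a, b)\<close> are
  recorded below.\<close>

lemma multi_affine_prod_diff:
  assumes "finite M" "inj_on fst M" "inj_on snd M" "fst ` M \<inter> snd ` M = {}"
  shows "multi_affine (fst ` M \<union> snd ` M) (\<lambda>x. \<Prod>p\<in>M. x (fst p) - x (snd p))"
  using assms
proof (induction M rule: finite_induct)
  case empty
  show ?case by (simp add: multi_affine_const)
next
  case (insert p M)
  have "multi_affine ({fst p, snd p} \<union> (fst ` M \<union> snd ` M))
      (\<lambda>x. (x (fst p) - x (snd p)) * (\<Prod>p\<in>M. x (fst p) - x (snd p)))"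
    using insert by (intro multi_affine_mult multi_affine_diff insert.IH) auto
  then show ?case using insert.hyps by (simp add: Un_commute insert_commute)
qed

text \<open>The simplest of the Garnir relations that cut out a Specht module.\<close>

lemma garnir_transpose:
  assumes "a \<noteq> b" "j \<noteq> a" "j \<noteq> b" and H: "multi_affine (- {a, b}) H"
    and f: "\<And>x. f x = (x a - x b) * H x"
  shows "f (x \<circ> Transposition.transpose a j) + f (x \<circ> Transposition.transpose b j) = f x"
proof -
  \<comment> \<open>As \<open>H\<close> ignores the coordinates \<open>a\<close> and
    \<open>b\<close>, only its affine dependence on coordinate \<open>j\<close> matters. The claim
    becomes \<open>(xj - xb)(p + q xa) + (xa - xj)(p + q xb) = (xa - xb)(p + q xj)\<close>.\<close>
  obtain p q where pq: "\<And>t. H (x(j := t)) = p + q * t"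
    using H unfolding multi_affine_def by metis
  have "H (x \<circ> Transposition.transpose a j) = H (x(j := x a))"
    by (rule multi_affineD[OF H]) (auto simp: Transposition.transpose_def)
  moreover have "H (x \<circ> Transposition.transpose b j) = H (x(j := x b))"
    by (rule multi_affineD[OF H]) (auto simp: Transposition.transpose_def)
  moreover have "H x = p + q * x j" using pq[of "x j"] by simp
  ultimately show ?thesis using assms(1-3) pq by (simp add: f algebra_simps)
qed

text \<open>Every transposition of \<open>{1..m}\<close> occurs twice in this sum, so that up to an additive constant this is
  \<open>-2\<close> times the class sum of the transpositions of the symmetric group \<open>S\<^sub>m\<close>.\<close>

definition swap_defect :: "nat \<Rightarrow> ((nat \<Rightarrow> real) \<Rightarrow> real) \<Rightarrow> (nat \<Rightarrow> real) \<Rightarrow> real" where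
  "swap_defect m f x = (\<Sum>i=1..m. \<Sum>j=1..m. f x - f (x \<circ> Transposition.transpose i j))"

lemma swap_defect_sum:
  "swap_defect m (\<lambda>x. \<Sum>a\<in>A. f a x) x = (\<Sum>a\<in>A. swap_defect m (f a) x)"
proof -
  have "swap_defect m (\<lambda>x. \<Sum>a\<in>A. f a x) x =
      (\<Sum>i=1..m. \<Sum>a\<in>A. \<Sum>j=1..m. f a x - f a (x \<circ> Transposition.transpose i j))"
    unfolding swap_defect_def sum_subtractf[symmetric] by (intro sum.cong refl sum.swap)
  also have "\<dots> = (\<Sum>a\<in>A. swap_defect m (f a) x)"
    unfolding swap_defect_def by (rule sum.swap)
  finally show ?thesis .
qed

text \<open>For fixed \<open>j\<close>, the differences at the two entries of a pair add up to
  \<open>f x\<close> by the Garnir relation, or to \<open>2 * f x\<close> if \<open>j\<close> lies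
  in the pair, because swapping its entries changes the sign. Two indices outside \<open>C\<close>
  contribute nothing. With \<open>k = card M\<close> the total is
  \<open>2k(k + 1) + 2k(m - 2k) = 2k(m + 1 - k)\<close> times \<open>f x\<close>.\<close>

lemma swap_defect_matching:
  fixes m :: nat
  assumes M: "finite M" "inj_on fst M" "inj_on snd M" "fst ` M \<inter> snd ` M = {}"
    and C: "C = fst ` M \<union> snd ` M" "C \<subseteq> {1..m}"
    and G: "multi_affine (- C) G"
    and sym: "\<And>i j x. i \<in> {1..m} - C \<Longrightarrow> j \<in> {1..m} - C \<Longrightarrow> G (x \<circ> Transposition.transpose i j) = G x"
    and f: "\<And>x. f x = (\<Prod>p\<in>M. x (fst p) - x (snd p)) * G x"
  shows "swap_defect m f x = 2 * real (card M) * (real m + 1 - real (card M)) * f x"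
proof -
  define k where "k = card M"
  define R where "R = {1..m} - C"
  let ?d = "\<lambda>i j. f x - f (x \<circ> Transposition.transpose i j)"
  have d_comm: "?d i j = ?d j i" for i j by (simp add: Transposition.transpose_commute)
  have finC: "finite C" using C(2) finite_subset by blast
  have sumC: "(\<Sum>i\<in>C. g i) = (\<Sum>p\<in>M. g (fst p) + g (snd p))" for g :: "nat \<Rightarrow> real"
    using M by (simp add: C sum.union_disjoint sum.reindex sum.distrib)
  have cardC: "card C = 2 * k"
    using M by (simp add: C card_Un_disjoint card_image k_def)
  have cardR: "real (card R) = real m - 2 * real k"
    unfolding R_def using C(2) finC cardC card_mono[OF _ C(2)] by (simp add: card_Diff_subset)
  have pair: "?d (fst p) j + ?d (snd p) j = (if j \<in> {fst p, snd p} then 2 else 1) * f x"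
    if p: "p \<in> M" for p j
  proof -
    \<comment> \<open>\<open>H\<close> is the cofactor of the factor belonging to \<open>p\<close>;
      it does not involve the entries of \<open>p\<close>, as the Garnir relation demands.\<close>
    define M' where "M' = M - {p}"
    define H where "H x = (\<Prod>p\<in>M'. x (fst p) - x (snd p)) * G x" for x
    have fp: "f x = (x (fst p) - x (snd p)) * H x" for x
      using M(1) p by (simp add: f H_def M'_def prod.remove[of M p] mult.assoc)
    have ne: "fst p \<noteq> snd p" using M(4) p by auto
    have C': "fst ` M' \<union> snd ` M' \<subseteq> C - {fst p, snd p}"
      using M p unfolding M'_def C inj_on_def by auto
    have "multi_affine ((fst ` M' \<union> snd ` M') \<union> - C) H"
      unfolding H_def using M C'
      by (intro multi_affine_mult multi_affine_prod_diff G) (auto simp: M'_def inj_on_def)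
    then have H: "multi_affine (- {fst p, snd p}) H"
      by (rule multi_affine_mono) (use C' p C(1) in auto)
    have flip: "f (x \<circ> Transposition.transpose (fst p) (snd p)) = - f x"
    proof -
      have "H (x \<circ> Transposition.transpose (fst p) (snd p)) = H x"
        by (rule multi_affineD[OF H]) (auto simp: Transposition.transpose_def)
      then show ?thesis using ne by (simp add: fp algebra_simps)
    qed
    show ?thesis
    proof (cases "j \<in> {fst p, snd p}")
      case True
      then show ?thesis using flip by (auto simp: Transposition.transpose_commute[of "snd p"])
    next
      case False
      then have "f (x \<circ> Transposition.transpose (fst p) j) + f (x \<circ> Transposition.transpose (snd p) j) = f x"
        by (intro garnir_transpose[OF ne _ _ H fp]) auto
      then have "?d (fst p) j + ?d (snd p) j = f x" by linarith
      then show ?thesis by (simp only: False if_False mult_1_left)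
    qed
  qed
  \<comment> \<open>Each \<open>j\<close> in \<open>C\<close> lies in exactly one pair of the
    matching, which accounts for the extra 1.\<close>
  have row: "(\<Sum>i\<in>C. ?d i j) = (real k + (if j \<in> C then 1 else 0)) * f x" for j
  proof -
    have "(\<Sum>p\<in>M. if j \<in> {fst p, snd p} then 1 else (0::real)) = (if j \<in> C then 1 else 0)"
    proof (cases "j \<in> C")
      case True
      then obtain p where p: "p \<in> M" "j \<in> {fst p, snd p}" by (auto simp: C)
      have "q = p" if q: "q \<in> M" "j \<in> {fst q, snd q}" for q
      proof -
        have "fst q \<noteq> snd p" "fst p \<noteq> snd q"
          using M(4) imageI[OF q(1), of fst] imageI[OF q(1), of snd]
            imageI[OF p(1), of fst] imageI[OF p(1), of snd] by (metis disjoint_iff)+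
        then have "fst q = fst p \<or> snd q = snd p" using p(2) q(2) by auto
        then show ?thesis using inj_onD[OF M(2) _ q(1) p(1)] inj_onD[OF M(3) _ q(1) p(1)] by blast
      qed
      then have "j \<in> {fst q, snd q} \<longleftrightarrow> q = p" if "q \<in> M" for q
        using p(2) that by blast
      then have "(\<Sum>q\<in>M. if j \<in> {fst q, snd q} then 1 else (0::real)) = (\<Sum>q\<in>M. if q = p then 1 else 0)"
        by (intro sum.cong) simp_all
      then show ?thesis using True p M(1) by simp
    next
      case False
      then have "j \<notin> {fst q, snd q}" if "q \<in> M" for q using that by (auto simp: C)
      then show ?thesis using False by simp
    qed
    moreover have "(\<Sum>i\<in>C. ?d i j) = (\<Sum>p\<in>M. (1 + (if j \<in> {fst p, snd p} then 1 else 0)) * f x)"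
      unfolding sumC using pair by (intro sum.cong) simp_all
    ultimately show ?thesis
      by (simp add: sum_distrib_right[symmetric] sum.distrib k_def)
  qed
  have rowC: "(\<Sum>i\<in>C. ?d i j) = (real k + 1) * f x" if "j \<in> C" for j
    using row[of j] that by (simp only: if_True)
  have rowR: "(\<Sum>i\<in>C. ?d i j) = real k * f x" if "j \<in> R" for j
  proof -
    have "j \<notin> C" using that by (simp add: R_def)
    then show ?thesis using row[of j] by (simp only: if_False add_0_right)
  qed
  have RR: "?d i j = 0" if "i \<in> R" "j \<in> R" for i j
  proof -
    have "(\<Prod>p\<in>M. (x \<circ> Transposition.transpose i j) (fst p) - (x \<circ> Transposition.transpose i j) (snd p)) =
        (\<Prod>p\<in>M. x (fst p) - x (snd p))"
      by (rule multi_affineD[OF multi_affine_prod_diff[OF M]])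
        (use that in \<open>auto simp: R_def C Transposition.transpose_def\<close>)
    then show ?thesis using sym[of i j x] that by (simp add: f R_def)
  qed
  have split: "(\<Sum>i=1..m. g i) = (\<Sum>i\<in>C. g i) + (\<Sum>i\<in>R. g i)" for g :: "nat \<Rightarrow> real"
    unfolding R_def using sum.subset_diff[OF C(2), of g] by (simp add: add.commute)
  have "swap_defect m f x = (\<Sum>j=1..m. \<Sum>i=1..m. ?d i j)"
    unfolding swap_defect_def by (rule sum.swap)
  also have "\<dots> = (\<Sum>j=1..m. \<Sum>i\<in>C. ?d i j) + (\<Sum>j=1..m. \<Sum>i\<in>R. ?d i j)"
    unfolding sum.distrib[symmetric] by (intro sum.cong refl split)
  \<comment> \<open>The block with both indices in \<open>R\<close> vanishes. By symmetry of the
    differences, the block left over is a sum of the expressions in \<open>rowR\<close>.\<close>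
  also have "(\<Sum>j=1..m. \<Sum>i\<in>R. ?d i j) = (\<Sum>j\<in>C. \<Sum>i\<in>R. ?d i j)"
    using RR by (intro trans[OF split]) (simp only: sum.neutral_const add_0_right cong: sum.cong)
  also have "\<dots> = (\<Sum>i\<in>R. \<Sum>j\<in>C. ?d j i)"
    by (rule trans[OF sum.swap]) (intro sum.cong refl d_comm)
  also have "\<dots> = (\<Sum>i\<in>R. real k * f x)"
    by (intro sum.cong refl rowR)
  also have "(\<Sum>j=1..m. \<Sum>i\<in>C. ?d i j) = (\<Sum>j\<in>C. (real k + 1) * f x) + (\<Sum>j\<in>R. real k * f x)"
    by (rule trans[OF split]) (intro arg_cong2[of _ _ _ _ "(+)"] sum.cong refl rowC rowR)
  finally have "swap_defect m f x = 2 * real k * ((real k + 1) * f x) + 2 * real (card R) * (real k * f x)"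
    by (simp add: cardC)
  then show ?thesis by (simp add: cardR k_def algebra_simps)
qed

text \<open>\<open>C\<close> is the set of indices that are already taken. For increasing \<open>bs\<close> the \<open>a\<^sub>i\<close> can be chosen
  successively, because \<open>a\<^sub>i < b\<^sub>i\<close> cannot clash with a later entry of \<open>bs\<close>.\<close>

fun nested_chi :: "nat set \<Rightarrow> nat list \<Rightarrow> (nat \<Rightarrow> real) \<Rightarrow> real" where
  "nested_chi C [] x = 1"
| "nested_chi C (b # bs) x =
     (\<Sum>a\<in>{1..<b} - C. (x a - x b) * nested_chi (insert a (insert b C)) bs x)"

text \<open>The recursive call excludes \<open>a\<close> and \<open>b\<close>, so the factor
  \<open>x a - x b\<close> and the rest involve disjoint sets of variables.\<close>

lemma multi_affine_nested_chi:
  assumes "sorted_wrt (<) bs" "set bs \<inter> C = {}"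
  shows "multi_affine (- C) (nested_chi C bs)"
  using assms
proof (induction bs arbitrary: C)
  case Nil
  show ?case by (simp add: multi_affine_const)
next
  case (Cons b bs)
  have "multi_affine (- C) (\<lambda>x. (x a - x b) * nested_chi (insert a (insert b C)) bs x)"
    if a: "a \<in> {1..<b} - C" for a
  proof (rule multi_affine_mono)
    show "multi_affine ({a, b} \<union> - insert a (insert b C))
        (\<lambda>x. (x a - x b) * nested_chi (insert a (insert b C)) bs x)"
      by (intro multi_affine_mult multi_affine_diff Cons.IH) (use Cons.prems a in auto)
  qed (use Cons.prems a in auto)
  then show ?case unfolding nested_chi.simps by (rule multi_affine_sum)
qed

text \<open>Every entry of \<open>bs\<close> exceeds \<open>m\<close>, so \<open>\<pi>\<close> fixes
  it and permutes the range from which its partner is chosen; only the excluded set is moved. This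
  supplies the symmetry hypothesis of \<open>swap_defect_matching\<close>.\<close>

lemma nested_chi_permute:
  assumes "\<pi> permutes {1..m}" "\<forall>b\<in>set bs. m < b"
  shows "nested_chi C bs (x \<circ> \<pi>) = nested_chi (\<pi> ` C) bs x"
  using assms(2)
proof (induction bs arbitrary: C)
  case (Cons b bs)
  have b: "\<pi> b = b" using Cons.prems assms(1) by (simp add: permutes_not_in)
  have \<pi>: "\<pi> permutes {1..<b}" by (rule permutes_subset[OF assms(1)]) (use Cons.prems in auto)
  have "nested_chi C (b # bs) (x \<circ> \<pi>) =
      (\<Sum>a\<in>{1..<b} - C. (x (\<pi> a) - x b) * nested_chi (insert (\<pi> a) (insert b (\<pi> ` C))) bs x)"
    unfolding nested_chi.simps using Cons.prems by (intro sum.cong) (simp_all add: b Cons.IH)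
  also have "\<dots> = nested_chi (\<pi> ` C) (b # bs) x"
    unfolding nested_chi.simps
  proof (rule sum.reindex_bij_betw)
    show "bij_betw \<pi> ({1..<b} - C) ({1..<b} - \<pi> ` C)"
      unfolding bij_betw_def
      using permutes_inj[OF \<pi>] image_set_diff[OF permutes_inj[OF \<pi>], of "{1..<b}" C]
        permutes_image[OF \<pi>] by (simp add: inj_on_subset[OF _ subset_UNIV])
  qed
  finally show ?case .
qed simp

text \<open>Only the entries up to \<open>m\<close> are expanded, each choice adding a pair
  \<open>(a, b)\<close> to \<open>M\<close>. Once the remaining entries all exceed \<open>m\<close>,
  the rest is symmetric in the free indices up to \<open>m\<close> and
  \<open>swap_defect_matching\<close> applies. The number \<open>k\<close> counts the chosen pairs
  together with the entries up to \<open>m\<close> still to come; it stays constant, so all summands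
  share one eigenvalue.\<close>

lemma swap_defect_nested_chi:
  fixes m :: nat
  assumes "finite M" "inj_on fst M" "inj_on snd M" "fst ` M \<inter> snd ` M = {}"
    and "C = fst ` M \<union> snd ` M" "C \<subseteq> {1..m}" "sorted_wrt (<) bs" "set bs \<inter> C = {}"
    and "k = card M + card (set bs \<inter> {..m})"
  shows "swap_defect m (\<lambda>x. (\<Prod>p\<in>M. x (fst p) - x (snd p)) * nested_chi C bs x) x =
    2 * real k * (real m + 1 - real k) * ((\<Prod>p\<in>M. x (fst p) - x (snd p)) * nested_chi C bs x)"
  using assms
proof (induction bs arbitrary: M C x)
  case Nil
  then show ?case
    using multi_affine_nested_chi[of "[]" C]
    by (intro trans[OF swap_defect_matching[of M C m "nested_chi C []"]]) simp_all
next
  case (Cons b bs)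
  show ?case
  proof (cases "b \<le> m")
    case True
    let ?P = "\<lambda>M x. (\<Prod>p\<in>M. x (fst p) - x (snd p)) :: real"
    have k: "k = Suc (card M + card (set bs \<inter> {..m}))"
    proof -
      have "b \<notin> set bs" using Cons.prems(7) by auto
      then show ?thesis using Cons.prems(9) True by simp
    qed
    have step: "swap_defect m (\<lambda>x. ?P (insert (a, b) M) x * nested_chi (insert a (insert b C)) bs x) x =
        2 * real k * (real m + 1 - real k) * (?P (insert (a, b) M) x * nested_chi (insert a (insert b C)) bs x)"
      and ins: "?P (insert (a, b) M) x = (x a - x b) * ?P M x"
      if a: "a \<in> {1..<b} - C" for a x
    proof -
      have b: "b \<notin> C" "b \<in> {1..m}" "\<forall>c\<in>set bs. b < c" "sorted_wrt (<) bs" "set bs \<inter> C = {}"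
        using Cons.prems(7,8) a True by auto
      have fresh: "a \<notin> fst ` M" "a \<notin> snd ` M" "b \<notin> fst ` M" "b \<notin> snd ` M"
        using a b(1) Cons.prems(5) by auto
      then have abM: "(a, b) \<notin> M" by (metis fst_conv image_eqI)
      then show "?P (insert (a, b) M) x = (x a - x b) * ?P M x"
        using Cons.prems(1) by simp
      show "swap_defect m (\<lambda>x. ?P (insert (a, b) M) x * nested_chi (insert a (insert b C)) bs x) x =
        2 * real k * (real m + 1 - real k) * (?P (insert (a, b) M) x * nested_chi (insert a (insert b C)) bs x)"
      proof (rule Cons.IH)
        show "inj_on fst (insert (a, b) M)" "inj_on snd (insert (a, b) M)"
          using Cons.prems(2,3) fresh abM by auto
        show "fst ` insert (a, b) M \<inter> snd ` insert (a, b) M = {}"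
          using Cons.prems(4) fresh a by auto
        show "insert a (insert b C) = fst ` insert (a, b) M \<union> snd ` insert (a, b) M"
          using Cons.prems(5) by auto
        show "set bs \<inter> insert a (insert b C) = {}"
          using a b(3,5) by auto
        show "k = card (insert (a, b) M) + card (set bs \<inter> {..m})"
          using k abM Cons.prems(1) by simp
      qed (use Cons.prems(1,6) a b in auto)
    qed
    have eq: "?P M x * nested_chi C (b # bs) x =
        (\<Sum>a\<in>{1..<b} - C. ?P (insert (a, b) M) x * nested_chi (insert a (insert b C)) bs x)" for x
      using ins by (simp add: sum_distrib_left mult_ac)
    show ?thesis
      unfolding eq swap_defect_sum using step by (simp add: sum_distrib_left)
  next
    case False
    then have gt: "\<forall>c\<in>set (b # bs). m < c" using Cons.prems(7) by auto
    then have "set (b # bs) \<inter> {..m} = {}" by fastforce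
    then have k: "k = card M" using Cons.prems(9) by simp
    have sym: "nested_chi C (b # bs) (x \<circ> Transposition.transpose i j) = nested_chi C (b # bs) x"
      if "i \<in> {1..m} - C" "j \<in> {1..m} - C" for i j x
    proof -
      have "Transposition.transpose i j ` C = C" using that by (auto simp: Transposition.transpose_def image_iff)
      then show ?thesis
        using nested_chi_permute[OF permutes_swap_id gt, of i j C x] that by auto
    qed
    show ?thesis
      unfolding k using Cons.prems sym multi_affine_nested_chi[OF Cons.prems(7,8)]
      by (intro swap_defect_matching[of M C m "nested_chi C (b # bs)"]) auto
  qed
qed

section \<open>The polynomials \<open>chi n B\<close> as iterated sums and eigenvectors\<close>

lemma finite_Seqs: "finite (Seqs n d)"
  by (rule finite_subset[OF _ finite_lists_length_eq[of "{1..n}" d]]) (auto simp: Seqs_def)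

lemma sum_seqs_eq_nested_chi:
  assumes "sorted_wrt (<) bs" "set bs \<subseteq> {1..n}" "set bs \<inter> C = {}"
  shows "(\<Sum>A\<in>{A \<in> Seqs n (length bs). set A \<inter> C = {} \<and> disjoint_seqs A bs \<and> seq_less A bs}.
     \<Prod>i<length bs. x (A ! i) - x (bs ! i)) = nested_chi C bs x"
  using assms
proof (induction bs arbitrary: C)
  case Nil
  have "{A \<in> Seqs n 0. set A \<inter> C = {} \<and> disjoint_seqs A [] \<and> seq_less A []} = {[]}"
    by (auto simp: Seqs_def disjoint_seqs_def seq_less_def)
  then show ?case by simp
next
  case (Cons b bs)
  let ?adm = "\<lambda>C bs. {A \<in> Seqs n (length bs). set A \<inter> C = {} \<and> disjoint_seqs A bs \<and> seq_less A bs}"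
  let ?C = "\<lambda>a. insert a (insert b C)"
  \<comment> \<open>Sequences are split into head and tail. Conversely, a head \<open>a < b\<close>
    lies in \<open>{1..n}\<close> and differs from all later entries of \<open>bs\<close>, which
    exceed \<open>b\<close>.\<close>
  have "?adm C (b # bs) = (\<lambda>(a, A). a # A) ` (SIGMA a:{1..<b} - C. ?adm (?C a) bs)"
  proof (intro set_eqI iffI)
    fix A assume A: "A \<in> ?adm C (b # bs)"
    then obtain a A' where "A = a # A'" by (cases A) (auto simp: Seqs_def)
    then show "A \<in> (\<lambda>(a, A). a # A) ` (SIGMA a:{1..<b} - C. ?adm (?C a) bs)"
      using A by (fastforce simp: Seqs_def disjoint_seqs_def seq_less_def)
  next
    fix A assume "A \<in> (\<lambda>(a, A). a # A) ` (SIGMA a:{1..<b} - C. ?adm (?C a) bs)"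
    then show "A \<in> ?adm C (b # bs)"
      using Cons.prems by (fastforce simp: Seqs_def disjoint_seqs_def seq_less_def)
  qed
  then have "(\<Sum>A\<in>?adm C (b # bs). \<Prod>i<length (b # bs). x (A ! i) - x ((b # bs) ! i)) =
      (\<Sum>(a, A)\<in>(SIGMA a:{1..<b} - C. ?adm (?C a) bs). \<Prod>i<length (b # bs). x ((a # A) ! i) - x ((b # bs) ! i))"
    by (simp add: sum.reindex inj_on_def case_prod_unfold)
  also have "\<dots> = (\<Sum>a\<in>{1..<b} - C. \<Sum>A\<in>?adm (?C a) bs. \<Prod>i<length (b # bs). x ((a # A) ! i) - x ((b # bs) ! i))"
    using finite_Seqs by (intro sum.Sigma[symmetric]) auto
  also have "\<dots> = (\<Sum>a\<in>{1..<b} - C. (x a - x b) * nested_chi (?C a) bs x)"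
  proof (rule sum.cong[OF refl])
    fix a assume "a \<in> {1..<b} - C"
    then have "(\<Sum>A\<in>?adm (?C a) bs. \<Prod>i<length bs. x (A ! i) - x (bs ! i)) = nested_chi (?C a) bs x"
      using Cons.prems by (intro Cons.IH) auto
    then show "(\<Sum>A\<in>?adm (?C a) bs. \<Prod>i<length (b # bs). x ((a # A) ! i) - x ((b # bs) ! i)) =
        (x a - x b) * nested_chi (?C a) bs x"
      by (simp add: prod.lessThan_Suc_shift sum_distrib_left[symmetric] del: prod.lessThan_Suc)
  qed
  finally show ?case by simp
qed

lemma peval_chi_eq_nested_chi:
  assumes "sorted_wrt (<) B" "set B \<subseteq> {1..n}"
  shows "peval (chi n B) x = nested_chi {} B x"
  using sum_seqs_eq_nested_chi[OF assms, of "{}" x] by (simp add: peval_chi)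

lemma swap_defect_chi:
  assumes "sorted_wrt (<) B" "set B \<subseteq> {1..n}" and "k = card (set B \<inter> {..m})"
  shows "swap_defect m (peval (chi n B)) x = 2 * real k * (real m + 1 - real k) * peval (chi n B) x"
proof -
  have "peval (chi n B) = nested_chi {} B"
    using peval_chi_eq_nested_chi[OF assms(1,2)] by blast
  then show ?thesis
    using swap_defect_nested_chi[of "{}" "{}" m B k x] assms by simp
qed

section \<open>Top sets and orthogonality\<close>

lemma Top_sets_lenD:
  assumes "B \<in> Top_sets_len n d"
  shows "sorted_wrt (<) B" "set B \<subseteq> {1..n}" "length B = d" "B \<in> Seqs n d"
  using assms by (auto simp: Top_sets_len_def Seqs_def)

text \<open>Every entry of \<open>B\<close> up to \<open>m\<close> brings along its smaller partner
  in \<open>A\<close>; all these indices are distinct and lie in \<open>{1..m}\<close>.\<close>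

lemma Top_sets_len_ballot:
  assumes "B \<in> Top_sets_len n d"
  shows "2 * card (set B \<inter> {..m}) \<le> m"
proof -
  obtain A where A: "A \<in> Seqs n d" "disjoint_seqs A B" "seq_less A B"
    and B: "B \<in> Seqs n d"
    using assms by (auto simp: Top_sets_len_def)
  have len: "length A = d" "length B = d" and dist: "distinct A" "distinct B"
    using A(1) B by (auto simp: Seqs_def)
  define I where "I = {i. i < d \<and> B ! i \<le> m}"
  have fin: "finite I" by (simp add: I_def)
  have less: "A ! i < B ! i" if "i < d" for i
    using A(3) that len by (simp add: seq_less_def list_all2_conv_all_nth)
  have "(!) A ` I \<union> (!) B ` I \<subseteq> {1..m}"
  proof -
    have "1 \<le> A ! i" "1 \<le> B ! i" if "i < d" for i
      using that A(1) B len subsetD[of "set A" "{1..n}", OF _ nth_mem] subsetD[of "set B" "{1..n}", OF _ nth_mem]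
      by (simp_all add: Seqs_def)
    then show ?thesis using less by (fastforce simp: I_def)
  qed
  then have "card ((!) A ` I \<union> (!) B ` I) \<le> m"
    using card_mono[of "{1..m}"] by fastforce
  moreover have "card ((!) A ` I \<union> (!) B ` I) = card ((!) A ` I) + card ((!) B ` I)"
  proof (rule card_Un_disjoint)
    have "(!) A ` I \<subseteq> set A" "(!) B ` I \<subseteq> set B" using len by (auto simp: I_def)
    then show "(!) A ` I \<inter> (!) B ` I = {}" using A(2) by (auto simp: disjoint_seqs_def)
  qed (use fin in auto)
  moreover have "inj_on ((!) A) I" "inj_on ((!) B) I"
    using dist len by (auto simp: I_def intro!: inj_on_nth)
  moreover have "set B \<inter> {..m} = (!) B ` I"
    using len by (auto simp: I_def set_conv_nth)
  ultimately show ?thesis by (simp add: card_image)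
qed

text \<open>The bound \<open>2 * length B \<le> n\<close> is the ballot inequality at
  \<open>m = n\<close>.\<close>

lemma Top_sets_iff: "B \<in> Top_sets n \<longleftrightarrow> B \<in> Top_sets_len n (length B)"
proof
  assume B: "B \<in> Top_sets_len n (length B)"
  have "distinct B" using Top_sets_lenD(4)[OF B] by (simp add: Seqs_def)
  moreover have "set B \<inter> {..n} = set B" using Top_sets_lenD(2)[OF B] by auto
  ultimately have "2 * length B \<le> n"
    using Top_sets_len_ballot[OF B, of n] by (simp add: distinct_card)
  then show "B \<in> Top_sets n" using B by (auto simp: Top_sets_def)
next
  assume "B \<in> Top_sets n"
  then show "B \<in> Top_sets_len n (length B)"
    using Top_sets_lenD(3) by (fastforce simp: Top_sets_def)
qed

lemma Top_sets_len_subset: "Top_sets_len n d \<subseteq> Top_sets n"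
proof
  fix B assume "B \<in> Top_sets_len n d"
  then show "B \<in> Top_sets n" using Top_sets_lenD(3) Top_sets_iff by metis
qed

lemma finite_Top_sets: "finite (Top_sets n)"
proof -
  have "Top_sets n \<subseteq> (\<Union>d\<le>n. Seqs n d)"
    by (fastforce simp: Top_sets_def Top_sets_len_def)
  then show ?thesis by (rule finite_subset) (simp add: finite_Seqs)
qed

text \<open>The count of elements up to \<open>m\<close> jumps exactly at the elements, so the
  counts determine the set, and the set determines the increasing list.\<close>

lemma sorted_seqs_separated:
  fixes n :: nat
  assumes "sorted_wrt (<) B1" "sorted_wrt (<) B2" "B1 \<noteq> B2"
    and "set B1 \<subseteq> {1..n}" "set B2 \<subseteq> {1..n}"
  obtains m where "m \<le> n" "card (set B1 \<inter> {..m}) \<noteq> card (set B2 \<inter> {..m})"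
proof (rule ccontr)
  assume "\<not> thesis"
  with that have eq: "card (set B1 \<inter> {..m}) = card (set B2 \<inter> {..m})" if "m \<le> n" for m
    using that by blast
  have step: "card (S \<inter> {..Suc i}) = card (S \<inter> {..i}) + (if Suc i \<in> S then 1 else 0)" for S :: "nat set" and i
  proof (cases "Suc i \<in> S")
    case True
    then have "S \<inter> {..Suc i} = insert (Suc i) (S \<inter> {..i})" by (auto simp: atMost_Suc)
    then show ?thesis using True by simp
  qed (simp add: atMost_Suc)
  have "i \<in> set B1 \<longleftrightarrow> i \<in> set B2" for i :: nat
  proof (cases "i \<in> {1..n}")
    case True
    then obtain j where j: "i = Suc j" "Suc j \<le> n" by (cases i) auto
    show ?thesis
      using eq[of j] eq[of "Suc j"] j step[of "set B1" j] step[of "set B2" j] by (auto split: if_splits)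
  next
    case False
    then show ?thesis using assms(4,5) by blast
  qed
  then have "set B1 = set B2" by blast
  then show False using strict_sorted_equal[OF assms(1,2)] assms(3) by simp
qed

text \<open>\<open>swap_defect m\<close> is self-adjoint for every permutation invariant form.\<close>

lemma swap_defect_orthogonal:
  assumes f: "\<And>x. swap_defect m f x = l * f x" and g: "\<And>x. swap_defect m g x = l' * g x"
    and "l \<noteq> l'" and int: "integrable M (\<lambda>x. f x * g x)"
    and int1: "\<And>i j. i \<in> {1..m} \<Longrightarrow> j \<in> {1..m} \<Longrightarrow> integrable M (\<lambda>x. f (x \<circ> Transposition.transpose i j) * g x)"
    and int2: "\<And>i j. i \<in> {1..m} \<Longrightarrow> j \<in> {1..m} \<Longrightarrow> integrable M (\<lambda>x. f x * g (x \<circ> Transposition.transpose i j))"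
    and adj: "\<And>i j. i \<in> {1..m} \<Longrightarrow> j \<in> {1..m} \<Longrightarrow>
      (LINT x|M. f (x \<circ> Transposition.transpose i j) * g x) = (LINT x|M. f x * g (x \<circ> Transposition.transpose i j))"
  shows "(LINT x|M. f x * g x) = 0"
proof -
  have dist: "(LINT x|M. (\<Sum>i=1..m. \<Sum>j=1..m. f x * g x - h i j x)) =
      (\<Sum>i=1..m. \<Sum>j=1..m. (LINT x|M. f x * g x) - (LINT x|M. h i j x))"
    if "\<And>i j. i \<in> {1..m} \<Longrightarrow> j \<in> {1..m} \<Longrightarrow> integrable M (h i j)" for h
    by (intro trans[OF Bochner_Integration.integral_sum] sum.cong refl Bochner_Integration.integral_diff
        Bochner_Integration.integrable_sum Bochner_Integration.integrable_diff that int)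
  have "l * (LINT x|M. f x * g x) = (LINT x|M. swap_defect m f x * g x)"
    by (simp add: f mult.assoc)
  also have "\<dots> = (LINT x|M. (\<Sum>i=1..m. \<Sum>j=1..m. f x * g x - f (x \<circ> Transposition.transpose i j) * g x))"
    by (simp add: swap_defect_def sum_distrib_right left_diff_distrib del: sum_subtractf)
  also have "\<dots> = (\<Sum>i=1..m. \<Sum>j=1..m. (LINT x|M. f x * g x) - (LINT x|M. f (x \<circ> Transposition.transpose i j) * g x))"
    by (rule dist[OF int1])
  also have "\<dots> = (\<Sum>i=1..m. \<Sum>j=1..m. (LINT x|M. f x * g x) - (LINT x|M. f x * g (x \<circ> Transposition.transpose i j)))"
    by (intro sum.cong refl arg_cong2[of _ _ _ _ "(-)"] adj)
  also have "\<dots> = (LINT x|M. (\<Sum>i=1..m. \<Sum>j=1..m. f x * g x - f x * g (x \<circ> Transposition.transpose i j)))"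
    by (rule dist[OF int2, symmetric])
  also have "\<dots> = (LINT x|M. f x * swap_defect m g x)"
    by (simp add: swap_defect_def sum_distrib_left right_diff_distrib del: sum_subtractf)
  also have "\<dots> = l' * (LINT x|M. f x * g x)"
    by (simp add: g mult.left_commute)
  finally show ?thesis using \<open>l \<noteq> l'\<close> by simp
qed

text \<open>The hypotheses on \<open>M\<close> are only integrability and self-adjointness of
  transpositions, so that both exchangeable measures and the counting measure on the cube are
  covered.\<close>

lemma chi_orthogonal:
  assumes B: "B1 \<in> Top_sets n" "B2 \<in> Top_sets n" "B1 \<noteq> B2"
    and int: "\<And>P Q i j. P \<in> Harm n \<Longrightarrow> Q \<in> Harm n \<Longrightarrow> i \<in> {1..n} \<Longrightarrow> j \<in> {1..n} \<Longrightarrow>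
      integrable M (\<lambda>x. peval P (x \<circ> Transposition.transpose i j) * peval Q x)"
    and int0: "\<And>P Q. P \<in> Harm n \<Longrightarrow> Q \<in> Harm n \<Longrightarrow> integrable M (\<lambda>x. peval P x * peval Q x)"
    and adj: "\<And>P Q i j. P \<in> Harm n \<Longrightarrow> Q \<in> Harm n \<Longrightarrow> i \<in> {1..n} \<Longrightarrow> j \<in> {1..n} \<Longrightarrow>
      (LINT x|M. peval P (x \<circ> Transposition.transpose i j) * peval Q x) =
      (LINT x|M. peval P x * peval Q (x \<circ> Transposition.transpose i j))"
  shows "(LINT x|M. peval (chi n B1) x * peval (chi n B2) x) = 0"
proof -
  have top: "B1 \<in> Top_sets_len n (length B1)" "B2 \<in> Top_sets_len n (length B2)"
    using B Top_sets_iff by auto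
  note D1 = Top_sets_lenD[OF top(1)] and D2 = Top_sets_lenD[OF top(2)]
  have harm: "chi n B1 \<in> Harm n" "chi n B2 \<in> Harm n"
    using chi_in_Harm_hom[OF D1(4)] chi_in_Harm_hom[OF D2(4)] by (auto simp: Harm_hom_def)
  obtain m where m: "m \<le> n" "card (set B1 \<inter> {..m}) \<noteq> card (set B2 \<inter> {..m})"
    using sorted_seqs_separated[OF D1(1) D2(1) B(3) D1(2) D2(2)] .
  define k where "k = card (set B1 \<inter> {..m})"
  define k' where "k' = card (set B2 \<inter> {..m})"
  have k: "2 * k \<le> m" "2 * k' \<le> m" "k \<noteq> k'"
    using Top_sets_len_ballot[OF top(1), of m] Top_sets_len_ballot[OF top(2), of m] m
    by (auto simp: k_def k'_def)
  show ?thesis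
  proof (rule swap_defect_orthogonal)
    show "swap_defect m (peval (chi n B1)) x = 2 * real k * (real m + 1 - real k) * peval (chi n B1) x" for x
      by (rule swap_defect_chi[OF D1(1,2) k_def])
    show "swap_defect m (peval (chi n B2)) x = 2 * real k' * (real m + 1 - real k') * peval (chi n B2) x" for x
      by (rule swap_defect_chi[OF D2(1,2) k'_def])
    \<comment> \<open>The eigenvalue is unchanged under replacing \<open>k\<close> by
      \<open>m + 1 - k\<close>; the ballot inequality puts \<open>k\<close> and \<open>k'\<close> on
      the same side, which makes the last factor positive.\<close>
    have "2 * real k * (real m + 1 - real k) - 2 * real k' * (real m + 1 - real k') =
        2 * (real k - real k') * (real m + 1 - real k - real k')"
      by (simp add: algebra_simps)
    moreover have "real m + 1 - real k - real k' > 0" "real k - real k' \<noteq> 0" using k by linarith+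
    ultimately show "2 * real k * (real m + 1 - real k) \<noteq> 2 * real k' * (real m + 1 - real k')"
      by (metis eq_iff_diff_eq_0 less_irrefl mult_eq_0_iff zero_neq_numeral)
    fix i j assume ij: "i \<in> {1..m}" "j \<in> {1..m}"
    then have ij': "i \<in> {1..n}" "j \<in> {1..n}" using m(1) by auto
    show "integrable M (\<lambda>x. peval (chi n B1) (x \<circ> Transposition.transpose i j) * peval (chi n B2) x)"
      by (rule int[OF harm ij'])
    show "integrable M (\<lambda>x. peval (chi n B1) x * peval (chi n B2) (x \<circ> Transposition.transpose i j))"
      using int[OF harm(2,1) ij'] by (simp add: mult.commute)
    show "(LINT x|M. peval (chi n B1) (x \<circ> Transposition.transpose i j) * peval (chi n B2) x) =
        (LINT x|M. peval (chi n B1) x * peval (chi n B2) (x \<circ> Transposition.transpose i j))"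
      by (rule adj[OF harm ij'])
  qed (rule int0[OF harm])
qed

section \<open>Orthogonality for exchangeable measures\<close>

lemma peval_cong:
  assumes "P \<in> polys_in n" "\<And>i. i \<in> {1..n} \<Longrightarrow> x i = y i"
  shows "peval P x = peval P y"
  unfolding peval_def
proof (rule sum.cong[OF refl])
  fix m assume "m \<in> Poly_Mapping.keys P"
  then have "Poly_Mapping.keys m \<subseteq> {1..n}" using assms(1) by (simp add: polys_in_def)
  then have "(\<Prod>i\<in>Poly_Mapping.keys m. x i ^ Poly_Mapping.lookup m i) =
      (\<Prod>i\<in>Poly_Mapping.keys m. y i ^ Poly_Mapping.lookup m i)"
    using assms(2) by (intro prod.cong) auto
  then show "Poly_Mapping.lookup P m * (\<Prod>i\<in>Poly_Mapping.keys m. x i ^ Poly_Mapping.lookup m i) =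
      Poly_Mapping.lookup P m * (\<Prod>i\<in>Poly_Mapping.keys m. y i ^ Poly_Mapping.lookup m i)"
    by simp
qed

lemma one_in_Harm: "1 \<in> Harm n"
  by (auto simp: Harm_def polys_in_def multilinear_def harmonic_one)

lemma exchangeable_measure_chi_orthogonal:
  assumes \<mu>: "exchangeable_measure n \<mu>"
    and B: "B1 \<in> Top_sets n" "B2 \<in> Top_sets n" "B1 \<noteq> B2"
  shows "poly_inner \<mu> (chi n B1) (chi n B2) = 0"
  unfolding poly_inner_def
proof (rule chi_orthogonal[OF B])
  let ?N = "Pi\<^sub>M {1..n} (\<lambda>_. borel :: real measure)"
  have sets: "sets \<mu> = sets ?N" using \<mu> by (simp add: exchangeable_measure_def)
  show int0: "integrable \<mu> (\<lambda>x. peval P x * peval Q x)" if "P \<in> Harm n" "Q \<in> Harm n" for P Q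
    using \<mu> that by (simp add: exchangeable_measure_def)
  \<comment> \<open>Measurability is read off from the integrability of the product with the
    harmonic polynomial 1.\<close>
  have meas: "peval P \<in> borel_measurable ?N" if "P \<in> Harm n" for P
    using int0[OF that one_in_Harm] measurable_cong_sets[OF sets refl]
    by (auto dest!: borel_measurable_integrable)
  \<comment> \<open>The composition with a transposition, restricted to \<open>{1..n}\<close> as in
    the definition of exchangeability; polynomials in these variables do not see the
    difference.\<close>
  define \<phi> where "\<phi> i j x = (\<lambda>k\<in>{1..n}. x (Transposition.transpose i j k))" for i j and x :: "nat \<Rightarrow> real"
  have comp: "peval P (x \<circ> Transposition.transpose i j) = peval P (\<phi> i j x)" if "P \<in> Harm n" for P x i j
    by (rule peval_cong[of _ n]) (use that in \<open>auto simp: Harm_def \<phi>_def\<close>)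
  fix i j assume ij: "i \<in> {1..n}" "j \<in> {1..n}"
  then have perm: "Transposition.transpose i j permutes {1..n}" by (simp add: permutes_swap_id)
  have distr: "distr \<mu> ?N (\<phi> i j) = \<mu>"
    using \<mu> perm unfolding \<phi>_def exchangeable_measure_def by blast
  have \<phi>: "\<phi> i j \<in> measurable \<mu> ?N"
    unfolding \<phi>_def measurable_cong_sets[OF sets refl]
    by (intro measurable_restrict measurable_component_singleton)
      (use permutes_in_image[OF perm] in auto)
  have invol: "peval P (\<phi> i j (\<phi> i j x)) = peval P x" if "P \<in> Harm n" for P x
    by (rule peval_cong[of _ n])
      (use that permutes_in_image[OF perm] in \<open>auto simp: Harm_def \<phi>_def\<close>)
  fix P Q assume PQ: "P \<in> Harm n" "Q \<in> Harm n"
  have [measurable]: "peval P \<in> borel_measurable ?N" "peval Q \<in> borel_measurable ?N"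
    "\<phi> i j \<in> measurable \<mu> ?N" "peval P \<in> borel_measurable \<mu>" "peval Q \<in> borel_measurable \<mu>"
    "\<phi> i j \<in> measurable ?N ?N"
    using meas PQ \<phi> measurable_cong_sets[OF sets refl] by auto
  have "integrable (distr \<mu> ?N (\<phi> i j)) (\<lambda>x. peval P x * peval P x)"
    using int0[OF PQ(1) PQ(1)] distr by simp
  then have PP: "integrable \<mu> (\<lambda>x. peval P (\<phi> i j x) * peval P (\<phi> i j x))"
    by (rule integrable_distr[OF \<phi>])
  \<comment> \<open>Domination by \<open>a * a + b * b\<close>: the square of the permuted factor is
    integrable by invariance of the measure, the other square by assumption.\<close>
  have "integrable \<mu> (\<lambda>x. peval P (\<phi> i j x) * peval Q x)"
  proof (rule Bochner_Integration.integrable_bound)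
    show "integrable \<mu> (\<lambda>x. peval P (\<phi> i j x) * peval P (\<phi> i j x) + peval Q x * peval Q x)"
      using PP int0[OF PQ(2) PQ(2)] by (rule Bochner_Integration.integrable_add)
    have "norm (a * b) \<le> norm (a * a + b * b)" for a b :: real
    proof -
      have "0 \<le> (\<bar>a\<bar> - \<bar>b\<bar>)\<^sup>2" by simp
      then have "2 * (\<bar>a\<bar> * \<bar>b\<bar>) \<le> a * a + b * b"
        by (simp add: power2_eq_square algebra_simps)
      moreover have "0 \<le> \<bar>a\<bar> * \<bar>b\<bar>" by simp
      ultimately have "\<bar>a\<bar> * \<bar>b\<bar> \<le> a * a + b * b" by linarith
      then show ?thesis by (simp add: abs_mult)
    qed
    then show "AE x in \<mu>. norm (peval P (\<phi> i j x) * peval Q x) \<le>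
        norm (peval P (\<phi> i j x) * peval P (\<phi> i j x) + peval Q x * peval Q x)" by simp
  qed measurable
  then show "integrable \<mu> (\<lambda>x. peval P (x \<circ> Transposition.transpose i j) * peval Q x)"
    using comp PQ by simp
  \<comment> \<open>Self-adjointness: substitute \<open>\<phi> i j\<close>, which preserves the
    measure and is an involution on the coordinates \<open>{1..n}\<close>.\<close>
  have "(LINT x|\<mu>. peval P (\<phi> i j x) * peval Q x) = (LINT x|distr \<mu> ?N (\<phi> i j). peval P (\<phi> i j x) * peval Q x)"
    using distr by simp
  also have "\<dots> = (LINT x|\<mu>. peval P (\<phi> i j (\<phi> i j x)) * peval Q (\<phi> i j x))"
    by (rule integral_distr[OF \<phi>]) measurable
  also have "\<dots> = (LINT x|\<mu>. peval P x * peval Q (\<phi> i j x))"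
    using invol[OF PQ(1)] by simp
  finally show "(LINT x|\<mu>. peval P (x \<circ> Transposition.transpose i j) * peval Q x) =
      (LINT x|\<mu>. peval P x * peval Q (x \<circ> Transposition.transpose i j))"
    using comp PQ by simp
qed

section \<open>Linear independence by means of the cube\<close>

definition cube :: "nat \<Rightarrow> (nat \<Rightarrow> real) set" where
  "cube n = PiE {1..n} (\<lambda>_. {0, 1})"

lemma finite_cube: "finite (cube n)"
  by (simp add: cube_def finite_PiE)

lemma cube_chi_orthogonal:
  assumes B: "B1 \<in> Top_sets n" "B2 \<in> Top_sets n" "B1 \<noteq> B2"
  shows "(\<Sum>x\<in>cube n. peval (chi n B1) x * peval (chi n B2) x) = 0"
proof -
  have int: "(LINT x|count_space (cube n). h x) = (\<Sum>x\<in>cube n. h x)" for h :: "(nat \<Rightarrow> real) \<Rightarrow> real"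
    using finite_cube by (rule lebesgue_integral_count_space_finite)
  have "(LINT x|count_space (cube n). peval (chi n B1) x * peval (chi n B2) x) = 0"
  proof (rule chi_orthogonal[OF B])
    fix P Q i j assume ij: "i \<in> {1..n}" "j \<in> {1..n}"
    let ?t = "Transposition.transpose i j"
    have perm: "?t permutes {1..n}" using ij by (simp add: permutes_swap_id)
    have closed: "x \<circ> ?t \<in> cube n" if "x \<in> cube n" for x
      using that permutes_in_image[OF perm] permutes_not_in[OF perm]
      unfolding cube_def PiE_iff extensional_def by auto
    have inv: "x \<circ> ?t \<circ> ?t = x" for x :: "nat \<Rightarrow> real" by (simp add: comp_assoc)
    have "(\<Sum>x\<in>cube n. peval P (x \<circ> ?t) * peval Q x) = (\<Sum>x\<in>cube n. peval P x * peval Q (x \<circ> ?t))"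
      by (rule sum.reindex_bij_witness[where i = "\<lambda>x. x \<circ> ?t" and j = "\<lambda>x. x \<circ> ?t"])
        (simp_all only: inv closed)
    then show "(LINT x|count_space (cube n). peval P (x \<circ> ?t) * peval Q x) =
        (LINT x|count_space (cube n). peval P x * peval Q (x \<circ> ?t))"
      by (simp only: int)
  qed (simp_all add: integrable_count_space finite_cube)
  then show ?thesis by (simp only: int)
qed

text \<open>At the indicator of \<open>B\<close> every factor \<open>x a - x b\<close> equals -1.
  All summands of \<open>chi n B\<close> then have the same value and cannot cancel, and a top set
  has at least one summand.\<close>

lemma cube_chi_positive:
  assumes "B \<in> Top_sets n"
  shows "(\<Sum>x\<in>cube n. peval (chi n B) x * peval (chi n B) x) > 0"
proof -
  let ?d = "length B"
  have top: "B \<in> Top_sets_len n ?d" using assms Top_sets_iff by blast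
  let ?S = "{A \<in> Seqs n ?d. disjoint_seqs A B \<and> seq_less A B}"
  let ?x = "\<lambda>i\<in>{1..n}. if i \<in> set B then 1 else 0 :: real"
  have "peval (chi n B) ?x = (\<Sum>A\<in>?S. \<Prod>i<?d. - 1)"
    unfolding peval_chi
  proof (intro sum.cong refl prod.cong)
    fix A i assume A: "A \<in> ?S" and i: "i \<in> {..<?d}"
    have "A ! i \<in> set A" "B ! i \<in> set B" using A i by (auto simp: Seqs_def)
    moreover have "set A \<subseteq> {1..n}" "set A \<inter> set B = {}" using A by (auto simp: Seqs_def disjoint_seqs_def)
    moreover note Top_sets_lenD(2)[OF top]
    ultimately have "A ! i \<in> {1..n}" "A ! i \<notin> set B" "B ! i \<in> {1..n}" "B ! i \<in> set B" by blast+
    then show "?x (A ! i) - ?x (B ! i) = - 1" by simp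
  qed
  then have "peval (chi n B) ?x = (- 1) ^ ?d * real (card ?S)" by simp
  moreover have "card ?S \<noteq> 0"
    using top finite_Seqs[of n ?d] by (auto simp: Top_sets_len_def)
  ultimately have "peval (chi n B) ?x \<noteq> 0" by simp
  then have "0 < peval (chi n B) ?x * peval (chi n B) ?x" by (meson not_real_square_gt_zero)
  moreover have "?x \<in> cube n" by (auto simp: cube_def)
  ultimately show ?thesis
    by (intro sum_pos2[OF finite_cube]) auto
qed

lemma inj_on_chi: "inj_on (chi n) (Top_sets n)"
proof (rule inj_onI, rule ccontr)
  fix B1 B2 assume "B1 \<in> Top_sets n" "B2 \<in> Top_sets n" "chi n B1 = chi n B2" "B1 \<noteq> B2"
  then show False using cube_chi_orthogonal[of B1 n B2] cube_chi_positive[of B2 n] by simp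
qed

text \<open>Pairing a vanishing combination with one of its members over the cube isolates the
  coefficient of that member, multiplied by a positive number.\<close>

lemma independent_chi:
  assumes "T \<subseteq> Top_sets n"
  shows "independent (chi n ` T)"
proof (rule real_vector.independent_if_scalars_zero)
  show "finite (chi n ` T)" using finite_subset[OF assms finite_Top_sets] by simp
  fix u v assume zero: "(\<Sum>w\<in>chi n ` T. u w *\<^sub>R w) = 0" and "v \<in> chi n ` T"
  then obtain B where B: "B \<in> T" "v = chi n B" by blast
  have inj: "inj_on (chi n) T" using inj_on_chi assms inj_on_subset by blast
  let ?ip = "\<lambda>P Q. \<Sum>x\<in>cube n. peval P x * peval Q x"
  have "0 = ?ip (\<Sum>w\<in>chi n ` T. u w *\<^sub>R w) v" by (simp only: zero) simp
  also have "\<dots> = (\<Sum>x\<in>cube n. \<Sum>B'\<in>T. u (chi n B') * (peval (chi n B') x * peval v x))"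
    by (simp add: sum.reindex[OF inj] sum_distrib_right mult.assoc)
  also have "\<dots> = (\<Sum>B'\<in>T. u (chi n B') * ?ip (chi n B') v)"
    by (subst sum.swap) (simp add: sum_distrib_left)
  also have "\<dots> = (\<Sum>B'\<in>T. if B' = B then u v * ?ip v v else 0)"
  proof (rule sum.cong[OF refl])
    fix B' assume "B' \<in> T"
    then show "u (chi n B') * ?ip (chi n B') v = (if B' = B then u v * ?ip v v else 0)"
      using cube_chi_orthogonal[of B' n B] assms B by auto
  qed
  also have "\<dots> = u v * ?ip v v"
    using B(1) finite_subset[OF assms finite_Top_sets] by simp
  finally show "u v = 0"
    using cube_chi_positive[of B n] assms B by auto
qed

section \<open>Spanning\<close>

definition mono_of :: "nat set \<Rightarrow> mono" where
  "mono_of S = (\<Sum>i\<in>S. Poly_Mapping.single i 1)"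

lemma lookup_mono_of:
  "finite S \<Longrightarrow> Poly_Mapping.lookup (mono_of S) i = (if i \<in> S then 1 else 0)"
  by (simp add: mono_of_def lookup_sum lookup_single when_def)

lemma keys_mono_of: "finite S \<Longrightarrow> Poly_Mapping.keys (mono_of S) = S"
  by (auto simp: in_keys_iff lookup_mono_of split: if_splits)

lemma mono_degree_mono_of: "finite S \<Longrightarrow> mono_degree (mono_of S) = card S"
  by (simp add: mono_degree_def keys_mono_of lookup_mono_of)

lemma multilinear_keys:
  assumes "multilinear P" "m \<in> Poly_Mapping.keys P"
  shows "m = mono_of (Poly_Mapping.keys m)"
proof (rule poly_mapping_eqI)
  fix i
  have "Poly_Mapping.lookup m i \<le> 1" using assms by (auto simp: multilinear_def)
  then show "Poly_Mapping.lookup m i = Poly_Mapping.lookup (mono_of (Poly_Mapping.keys m)) i"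
    by (auto simp: lookup_mono_of in_keys_iff)
qed

text \<open>This is the coefficient of \<open>mono_of T\<close> in the sum of the partial
  derivatives. Indices in \<open>T\<close> drop out because they would lead to a monomial that is
  not squarefree.\<close>

lemma Harm_coeff_relation:
  assumes P: "P \<in> Harm n" and T: "T \<subseteq> {1..n}"
  shows "(\<Sum>j\<in>{1..n} - T. Poly_Mapping.lookup P (mono_of (insert j T))) = 0"
proof -
  have fin: "finite T" using T finite_subset by blast
  have ml: "multilinear P" and h: "(\<Sum>i=1..n. partial_deriv i P) = 0"
    using P by (auto simp: Harm_def harmonic_def)
  have "0 = Poly_Mapping.lookup (\<Sum>i=1..n. partial_deriv i P) (mono_of T)" by (simp only: h lookup_zero)
  also have "\<dots> = (\<Sum>i=1..n. (real (Poly_Mapping.lookup (mono_of T) i) + 1) *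
      Poly_Mapping.lookup P (mono_of T + Poly_Mapping.single i 1))"
    by (simp add: lookup_sum lookup_partial_deriv)
  also have "\<dots> = (\<Sum>i\<in>{1..n} - T. Poly_Mapping.lookup P (mono_of (insert i T)))"
  proof (rule sum.mono_neutral_cong_right)
    show "\<forall>i\<in>{1..n} - ({1..n} - T). (real (Poly_Mapping.lookup (mono_of T) i) + 1) *
        Poly_Mapping.lookup P (mono_of T + Poly_Mapping.single i 1) = 0"
    proof
      fix i assume "i \<in> {1..n} - ({1..n} - T)"
      then have "Poly_Mapping.lookup (mono_of T + Poly_Mapping.single i 1) i = 2"
        using fin by (simp add: lookup_add lookup_mono_of)
      then have "\<not> Poly_Mapping.lookup (mono_of T + Poly_Mapping.single i 1) i \<le> 1" by linarith
      then have "mono_of T + Poly_Mapping.single i 1 \<notin> Poly_Mapping.keys P"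
        using ml unfolding multilinear_def by blast
      then show "(real (Poly_Mapping.lookup (mono_of T) i) + 1) *
          Poly_Mapping.lookup P (mono_of T + Poly_Mapping.single i 1) = 0"
        by (simp add: in_keys_iff)
    qed
    fix i assume "i \<in> {1..n} - T"
    then show "(real (Poly_Mapping.lookup (mono_of T) i) + 1) *
        Poly_Mapping.lookup P (mono_of T + Poly_Mapping.single i 1) = Poly_Mapping.lookup P (mono_of (insert i T))"
      using fin by (simp add: lookup_mono_of) (simp add: mono_of_def add.commute)
  qed auto
  finally show ?thesis by simp
qed

text \<open>A harmonic form \<open>p\<close> of degree \<open>t\<close> is invariant under \<open>x \<mapsto> x - 1\<close>. Evaluating at the indicator of
  a \<open>t\<close>-set \<open>S\<close> gives the coefficient of \<open>S\<close>; shifting by \<open>-1\<close> gives \<open>p\<close> at minus the indicator of the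
  complement, where every monomial vanishes once the complement has fewer than \<open>t\<close> elements.\<close>

lemma harmonic_coeff_eq_0:
  fixes g :: "'a set \<Rightarrow> real"
  assumes V: "finite V" "S \<subseteq> V" "card V < 2 * card S"
    and g: "\<And>T. T \<subseteq> V \<Longrightarrow> (\<Sum>j\<in>V - T. g (insert j T)) = 0"
  shows "g S = 0"
proof -
  define t where "t = card S"
  define K where "K = {S'. S' \<subseteq> V \<and> card S' = t}"
  define p where "p x = (\<Sum>S'\<in>K. g S' * (\<Prod>i\<in>S'. x i))" for x :: "'a \<Rightarrow> real"
  have finK: "finite K" using V(1) by (simp add: K_def)
  have finS: "finite S'" if "S' \<in> K" for S' using that V(1) finite_subset by (auto simp: K_def)
  \<comment> \<open>Positivity makes the truncated \<open>t - 1\<close> in \<open>?L\<close>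
    exact.\<close>
  have t: "t > 0" using V(3) by (simp add: t_def)
  let ?L = "{T. T \<subseteq> V \<and> card T = t - 1}"
  have deriv: "((\<lambda>s. p (\<lambda>i. x i + s)) has_field_derivative 0) (at s)" for x s
  proof -
    let ?y = "\<lambda>T. \<Prod>i\<in>T. x i + s"
    have "((\<lambda>s. p (\<lambda>i. x i + s)) has_field_derivative (\<Sum>S'\<in>K. g S' * (\<Sum>j\<in>S'. 1 * ?y (S' - {j})))) (at s)"
      unfolding p_def
      by (intro DERIV_sum DERIV_cmult has_field_derivative_prod) (auto intro!: derivative_eq_intros)
    also have "(\<Sum>S'\<in>K. g S' * (\<Sum>j\<in>S'. 1 * ?y (S' - {j}))) = (\<Sum>(S', j)\<in>(SIGMA S':K. S'). g S' * ?y (S' - {j}))"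
      using finK finS by (simp add: sum_distrib_left sum.Sigma)
    \<comment> \<open>Regrouping by the set \<open>T\<close> left after deleting \<open>j\<close>
      turns the coefficient of each \<open>T\<close> into a sum assumed to vanish.\<close>
    also have "\<dots> = (\<Sum>(T, j)\<in>(SIGMA T:?L. V - T). g (insert j T) * ?y T)"
    proof (rule sum.reindex_bij_witness[where i = "\<lambda>(T, j). (insert j T, j)" and j = "\<lambda>(S', j). (S' - {j}, j)"])
      fix a assume "a \<in> (SIGMA S':K. S')"
      then obtain S' j where a: "a = (S', j)" "S' \<in> K" "j \<in> S'" by blast
      then have "insert j (S' - {j}) = S'" "S' - {j} \<in> ?L" "j \<in> V - (S' - {j})"
        using finS[OF a(2)] by (auto simp: K_def)
      then show "(case case a of (S', j) \<Rightarrow> (S' - {j}, j) of (T, j) \<Rightarrow> (insert j T, j)) = a"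
        "(case a of (S', j) \<Rightarrow> (S' - {j}, j)) \<in> (SIGMA T:?L. V - T)"
        "(case case a of (S', j) \<Rightarrow> (S' - {j}, j) of (T, j) \<Rightarrow> g (insert j T) * ?y T) =
          (case a of (S', j) \<Rightarrow> g S' * ?y (S' - {j}))"
        by (simp_all add: a(1))
    next
      fix b assume "b \<in> (SIGMA T:?L. V - T)"
      then obtain T j where b: "b = (T, j)" "T \<in> ?L" "j \<in> V - T" by blast
      have "finite T" using b(2) finite_subset[OF _ V(1)] by blast
      then have "insert j T - {j} = T" "insert j T \<in> K"
        using b(2,3) t by (auto simp: K_def)
      then show "(case case b of (T, j) \<Rightarrow> (insert j T, j) of (S', j) \<Rightarrow> (S' - {j}, j)) = b"
        "(case b of (T, j) \<Rightarrow> (insert j T, j)) \<in> (SIGMA S':K. S')"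
        by (simp_all add: b(1))
    qed
    also have "\<dots> = (\<Sum>T\<in>?L. (\<Sum>j\<in>V - T. g (insert j T)) * ?y T)"
      using V(1) by (simp add: sum.Sigma[symmetric] sum_distrib_right)
    also have "\<dots> = 0" using g by (intro sum.neutral) simp
    finally show ?thesis .
  qed
  let ?x = "\<lambda>i. if i \<in> S then 1 else 0 :: real"
  have "g S = (\<Sum>S'\<in>K. if S' = S then g S else 0)"
    using finK V(2) by (simp add: K_def t_def)
  also have "\<dots> = p (\<lambda>i. ?x i + 0)"
    unfolding p_def
  proof (rule sum.cong[OF refl])
    fix S' assume S': "S' \<in> K"
    show "(if S' = S then g S else 0) = g S' * (\<Prod>i\<in>S'. ?x i + 0)"
    proof (cases "S' = S")
      case False
      then have "\<not> S' \<subseteq> S"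
        using S' card_subset_eq[of S S'] finite_subset[OF V(2,1)] by (auto simp: K_def t_def)
      then have "\<exists>i\<in>S'. ?x i + 0 = 0" by auto
      then have "(\<Prod>i\<in>S'. ?x i + 0) = 0" using finS[OF S'] by (simp add: prod_zero_iff)
      then show ?thesis using False by simp
    qed simp
  qed
  also have "\<dots> = p (\<lambda>i. ?x i + - 1)"
    by (rule DERIV_isconst_all[of "\<lambda>s. p (\<lambda>i. ?x i + s)"]) (intro allI deriv)
  also have "\<dots> = 0"
    unfolding p_def
  proof (rule sum.neutral, rule ballI)
    fix S' assume S': "S' \<in> K"
    have "S' \<inter> S \<noteq> {}"
    proof
      assume "S' \<inter> S = {}"
      then have "card (S' \<union> S) = 2 * card S"
        using S' finS[OF S'] finite_subset[OF V(2,1)] by (simp add: card_Un_disjoint K_def t_def)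
      moreover have "card (S' \<union> S) \<le> card V"
        using S' V by (intro card_mono) (auto simp: K_def)
      ultimately show False using V(3) by simp
    qed
    then have "\<exists>i\<in>S'. ?x i + - 1 = 0" by auto
    then have "(\<Prod>i\<in>S'. ?x i + - 1) = 0" using finS[OF S'] by (simp add: prod_zero_iff)
    then show "g S' * (\<Prod>i\<in>S'. ?x i + - 1) = 0" by simp
  qed
  finally show ?thesis .
qed

section \<open>Ballot sets are top sets\<close>

text \<open>Greedy choice: there are \<open>b - 1 > card C\<close> positive indices below
  \<open>b\<close>, so one is free. Adding it and \<open>b\<close> enlarges \<open>C\<close> by at
  most two, which the summand \<open>2 * i\<close> absorbs.\<close>

lemma exists_matching_seq:
  assumes "sorted_wrt (<) bs" "set bs \<inter> C = {}" "finite C"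
    and "\<And>i. i < length bs \<Longrightarrow> card C + 2 * i + 2 \<le> bs ! i"
  shows "\<exists>A. length A = length bs \<and> distinct A \<and> set A \<inter> (C \<union> set bs) = {} \<and> list_all2 (<) A bs \<and> 0 \<notin> set A"
  using assms
proof (induction bs arbitrary: C)
  case (Cons b bs)
  have "card C + 2 \<le> b" using Cons.prems(4)[of 0] by simp
  then have "card C < card {1..<b}" by simp
  then have "\<not> {1..<b} \<subseteq> C" using card_mono[OF Cons.prems(3)] by (meson linorder_not_less)
  then obtain a where a: "a \<in> {1..<b}" "a \<notin> C" by blast
  have "\<exists>A. length A = length bs \<and> distinct A \<and> set A \<inter> (insert a (insert b C) \<union> set bs) = {} \<and>
      list_all2 (<) A bs \<and> 0 \<notin> set A"
  proof (rule Cons.IH)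
    fix i assume "i < length bs"
    moreover have "card (insert a (insert b C)) \<le> card C + 2"
      using Cons.prems(3) by (simp add: card_insert_if)
    ultimately show "card (insert a (insert b C)) + 2 * i + 2 \<le> bs ! i"
      using Cons.prems(4)[of "Suc i"] by simp
  qed (use Cons.prems a in auto)
  then obtain A where "length A = length bs" "distinct A" "set A \<inter> (insert a (insert b C) \<union> set bs) = {}"
      "list_all2 (<) A bs" "0 \<notin> set A" by blast
  then show ?case using a Cons.prems by (intro exI[of _ "a # A"]) auto
qed simp

lemma ballot_imp_Top_sets:
  assumes S: "S \<subseteq> {1..n}" and ballot: "\<And>m. m \<le> n \<Longrightarrow> 2 * card (S \<inter> {..m}) \<le> m"
  shows "sorted_list_of_set S \<in> Top_sets n"
proof -
  define B where "B = sorted_list_of_set S"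
  have fin: "finite S" using S finite_subset by blast
  have B: "sorted_wrt (<) B" "set B = S" "distinct B" "length B = card S"
    using fin by (auto simp: B_def)
  \<comment> \<open>The ballot inequality at \<open>m = B ! i\<close>, where at least
    \<open>i + 1\<close> elements of \<open>S\<close> have been reached.\<close>
  have "2 * i + 2 \<le> B ! i" if i: "i < length B" for i
  proof -
    have mem: "B ! i \<in> S" using i B(2) nth_mem by blast
    have "(!) B ` {..i} \<subseteq> S \<inter> {..B ! i}"
    proof
      fix b assume "b \<in> (!) B ` {..i}"
      then obtain j where j: "j \<le> i" "b = B ! j" by auto
      then have "b \<in> S" using i B(2) nth_mem[of j B] by auto
      moreover have "b \<le> B ! i"
        using j i sorted_wrt_nth_less[OF B(1), of j i] by (cases "j = i") auto
      ultimately show "b \<in> S \<inter> {..B ! i}" by simp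
    qed
    then have "card ((!) B ` {..i}) \<le> card (S \<inter> {..B ! i})" using fin by (intro card_mono) auto
    moreover have "inj_on ((!) B) {..i}" using B(3) i by (intro inj_on_nth) auto
    then have "card ((!) B ` {..i}) = Suc i" by (simp add: card_image)
    moreover have "2 * card (S \<inter> {..B ! i}) \<le> B ! i" using mem S by (intro ballot) auto
    ultimately show ?thesis by linarith
  qed
  then obtain A where A: "length A = length B" "distinct A" "set A \<inter> set B = {}" "list_all2 (<) A B" "0 \<notin> set A"
    using exists_matching_seq[of B "{}"] B(1) by auto
  have BS: "B \<in> Seqs n (length B)" using B S by (auto simp: Seqs_def)
  have "a \<in> {1..n}" if a: "a \<in> set A" for a
  proof -
    obtain i where i: "i < length B" "a = A ! i" using a A(1) by (metis in_set_conv_nth)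
    have "A ! i < B ! i" using A(1,4) i by (simp add: list_all2_conv_all_nth)
    moreover have "B ! i \<le> n" using i B(2) S nth_mem[OF i(1)] by auto
    moreover have "a \<noteq> 0" using a A(5) by metis
    ultimately show ?thesis using i by auto
  qed
  then have "A \<in> Seqs n (length B)" using A by (auto simp: Seqs_def)
  then have "B \<in> Top_sets_len n (length B)"
    using A BS B(1) by (auto simp: Top_sets_len_def disjoint_seqs_def seq_less_def)
  then show ?thesis using Top_sets_iff B_def by blast
qed

text \<open>The monomial of \<open>P\<close> that is largest in colexicographic order (the order given by the weight
  \<open>\<Sum>i\<in>S. 2 ^ i\<close>) belongs to a top set: otherwise some initial segment of it is more than half full, and
  fixing the remaining variables leaves a harmonic form of too large degree.\<close>

lemma Harm_eq_0:
  assumes P: "P \<in> Harm n" and zero: "\<And>B. B \<in> Top_sets n \<Longrightarrow> Poly_Mapping.lookup P (mono_of (set B)) = 0"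
  shows "P = 0"
proof (rule ccontr)
  assume "P \<noteq> 0"
  define c where "c S = Poly_Mapping.lookup P (mono_of S)" for S
  define w where "w S = (\<Sum>i\<in>S. 2 ^ i :: nat)" for S
  define Q where "Q = {S. S \<subseteq> {1..n} \<and> c S \<noteq> 0}"
  have "finite Q" by (simp add: Q_def)
  moreover have "Q \<noteq> {}"
  proof -
    obtain m where m: "m \<in> Poly_Mapping.keys P"
      using \<open>P \<noteq> 0\<close> by (metis ex_in_conv lookup_zero not_in_keys_iff_lookup_eq_zero poly_mapping_eqI)
    then have "Poly_Mapping.keys m \<in> Q"
      using P multilinear_keys[of P m] by (auto simp: Q_def c_def Harm_def polys_in_def in_keys_iff)
    then show ?thesis by blast
  qed
  ultimately obtain S where S: "S \<in> Q" and max: "\<And>S'. S' \<in> Q \<Longrightarrow> w S' \<le> w S"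
    using Max_in[of "w ` Q"] Max_ge[of "w ` Q"] by (metis (no_types, lifting) finite_imageI image_iff image_is_empty)
  have Sn: "S \<subseteq> {1..n}" and cS: "c S \<noteq> 0" using S by (auto simp: Q_def)
  have fin: "finite S" using Sn finite_subset by blast
  have "\<not> (\<forall>m\<le>n. 2 * card (S \<inter> {..m}) \<le> m)"
    using ballot_imp_Top_sets[OF Sn] zero[of "sorted_list_of_set S"] cS fin by (auto simp: c_def)
  then obtain m where m: "m \<le> n" "m < 2 * card (S \<inter> {..m})" by (auto simp: not_le)
  define S1 where "S1 = S \<inter> {..m}"
  define S2 where "S2 = S - {..m}"
  have S12: "S1 \<union> S2 = S" "S1 \<inter> S2 = {}" by (auto simp: S1_def S2_def)
  have S1: "S1 \<subseteq> {1..m}" using Sn by (auto simp: S1_def)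
  have "w S1 \<le> w {..m}" unfolding w_def S1_def by (intro sum_mono2) auto
  also have "w {..m} < 2 ^ Suc m" unfolding w_def by (induction m) auto
  finally have wS1: "w S1 < 2 ^ Suc m" .
  have "c (S1 \<union> S2) = 0"
  proof (rule harmonic_coeff_eq_0[of "{1..m}" S1 "\<lambda>T. c (T \<union> S2)"])
    show "card {1..m} < 2 * card S1" using m(2) by (simp add: S1_def)
    fix T assume T: "T \<subseteq> {1..m}"
    have fT: "finite T" using T finite_subset by blast
    have T2: "T \<union> S2 \<subseteq> {1..n}" using T m(1) Sn by (auto simp: S2_def)
    \<comment> \<open>Such a \<open>j\<close> exceeds \<open>m\<close>, and its weight
      \<open>2 ^ j\<close> alone outweighs \<open>S1\<close>, against the maximality of
      \<open>S\<close>. Hence the harmonic relation in \<open>n\<close> variables restricts to one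
      in the first \<open>m\<close>.\<close>
    have big: "c (insert j (T \<union> S2)) = 0" if j: "j \<in> {1..n} - (T \<union> S2) - ({1..m} - T)" for j
    proof (rule ccontr)
      assume "c (insert j (T \<union> S2)) \<noteq> 0"
      then have "insert j (T \<union> S2) \<in> Q" using T2 j by (auto simp: Q_def)
      then have "w (insert j (T \<union> S2)) \<le> w S" by (rule max)
      moreover have "w S = w S1 + w S2"
        unfolding w_def S12(1)[symmetric] using fin S12(2) by (intro sum.union_disjoint) (auto simp: S1_def S2_def)
      moreover have "2 ^ j + w S2 = w (insert j S2)"
        using j fin by (simp add: w_def S2_def)
      moreover have "w (insert j S2) \<le> w (insert j (T \<union> S2))"
        unfolding w_def using fin fT by (intro sum_mono2) (auto simp: S2_def)
      moreover have "(2::nat) ^ Suc m \<le> 2 ^ j"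
        using j by (intro power_increasing) auto
      ultimately show False using wS1 by linarith
    qed
    have "(\<Sum>j\<in>{1..m} - T. c (insert j (T \<union> S2))) = (\<Sum>j\<in>{1..n} - (T \<union> S2). c (insert j (T \<union> S2)))"
    proof (rule sum.mono_neutral_left)
      show "{1..m} - T \<subseteq> {1..n} - (T \<union> S2)" using m(1) by (auto simp: S2_def)
      show "\<forall>j\<in>{1..n} - (T \<union> S2) - ({1..m} - T). c (insert j (T \<union> S2)) = 0"
        using big by blast
    qed simp
    also have "\<dots> = 0" unfolding c_def by (rule Harm_coeff_relation[OF P T2])
    finally show "(\<Sum>j\<in>{1..m} - T. c (insert j T \<union> S2)) = 0" by simp
  qed (use S1 in auto)
  then show False using cS S12(1) by simp
qed

section \<open>Dimension count\<close>

text \<open>The functionals embed \<open>V\<close> into a space of dimension at most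
  \<open>card I\<close>, so an independent set in \<open>V\<close> with at least that many elements
  cannot be enlarged.\<close>

lemma span_eq_by_separating_functionals:
  fixes V :: "'a::real_vector set" and l :: "'i \<Rightarrow> 'a \<Rightarrow> real"
  assumes V: "subspace V" and X: "X \<subseteq> V" "independent X" "finite X" "card I \<le> card X" "finite I"
    and l: "\<And>i. linear (l i)" and sep: "\<And>v. v \<in> V \<Longrightarrow> (\<And>i. i \<in> I \<Longrightarrow> l i v = 0) \<Longrightarrow> v = 0"
  shows "span X = V"
proof (rule ccontr)
  assume "span X \<noteq> V"
  moreover have "span X \<subseteq> V" by (rule span_minimal[OF X(1) V])
  ultimately obtain v where v: "v \<in> V" "v \<notin> span X" by blast
  \<comment> \<open>Finitely supported functions serve as the coordinate space; the image lies in
    the span of the unit vectors indexed by \<open>I\<close>.\<close>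
  define \<phi> where "\<phi> u = (\<Sum>i\<in>I. l i u *\<^sub>R Poly_Mapping.single i (1::real))" for u
  have lin: "linear \<phi>"
    by (rule linearI) (simp_all add: \<phi>_def linear_add[OF l] linear_scale[OF l] scaleR_add_left sum.distrib scaleR_sum_right)
  have look: "Poly_Mapping.lookup (\<phi> u) i = l i u" if "i \<in> I" for u i
    using that X(5) by (simp add: \<phi>_def lookup_sum lookup_single when_def if_distrib[of "(*) _"] cong: if_cong)
  have ins: "independent (insert v X)" using v(2) X(2) by (rule independent_insertI)
  have "span (insert v X) \<subseteq> V" using X(1) v(1) V by (intro span_minimal) auto
  have inj: "inj_on \<phi> (span (insert v X))"
  proof (rule inj_onI)
    fix a b assume ab: "a \<in> span (insert v X)" "b \<in> span (insert v X)" "\<phi> a = \<phi> b"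
    then have "a - b \<in> V" using \<open>span (insert v X) \<subseteq> V\<close> V by (blast intro: subspace_diff)
    moreover have "l i (a - b) = 0" if "i \<in> I" for i
      using look[OF that, of a] look[OF that, of b] ab(3) by (simp add: linear_diff[OF l])
    ultimately show "a = b" using sep[of "a - b"] by simp
  qed
  have "independent (\<phi> ` insert v X)"
    by (rule linear_independent_injective_image[OF lin ins inj])
  moreover have "\<phi> u \<in> span ((\<lambda>i. Poly_Mapping.single i (1::real)) ` I)" for u
    unfolding \<phi>_def by (intro span_sum span_scale span_base imageI)
  then have "\<phi> ` insert v X \<subseteq> span ((\<lambda>i. Poly_Mapping.single i (1::real)) ` I)" by blast
  ultimately have "card (\<phi> ` insert v X) \<le> card ((\<lambda>i. Poly_Mapping.single i (1::real)) ` I)"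
    using independent_span_bound[of "(\<lambda>i. Poly_Mapping.single i (1::real)) ` I" "\<phi> ` insert v X"] X(5) by blast
  also have "\<dots> \<le> card X" using card_image_le[OF X(5)] X(4) by (rule le_trans)
  also have "card (\<phi> ` insert v X) = card (insert v X)"
    by (rule card_image[OF inj_on_subset[OF inj span_superset]])
  also have "card (insert v X) = Suc (card X)"
    using v(2) X(3) span_base[of v X] by (subst card_insert_disjoint) auto
  finally show False by simp
qed

lemma linear_lookup: "linear (\<lambda>P :: 'a \<Rightarrow>\<^sub>0 real. Poly_Mapping.lookup P m)"
  by (rule linearI) (simp_all add: lookup_add)

text \<open>The coefficients at the sets of \<open>T\<close> provide one functional for each of the
  independent polynomials, whose number is \<open>card T\<close> by
  \<open>inj_on_chi\<close>.\<close>

lemma span_chi: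
  assumes "subspace V" "chi n ` T \<subseteq> V" "T \<subseteq> Top_sets n"
    and "\<And>P. P \<in> V \<Longrightarrow> (\<And>B. B \<in> T \<Longrightarrow> Poly_Mapping.lookup P (mono_of (set B)) = 0) \<Longrightarrow> P = 0"
  shows "span (chi n ` T) = V"
proof -
  have fin: "finite T" using finite_subset[OF assms(3) finite_Top_sets] .
  have "card (chi n ` T) = card T"
    by (rule card_image[OF inj_on_subset[OF inj_on_chi assms(3)]])
  then show ?thesis
    using fin by (intro span_eq_by_separating_functionals[of V _ T "\<lambda>B P. Poly_Mapping.lookup P (mono_of (set B))"]
        assms independent_chi linear_lookup) auto
qed

lemma chi_in_Harm: "B \<in> Top_sets n \<Longrightarrow> chi n B \<in> Harm n"
  using Top_sets_iff[of B n] chi_in_Harm_hom[OF Top_sets_lenD(4)] by (auto simp: Harm_hom_def)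

lemma span_chi_Harm: "span (chi n ` Top_sets n) = Harm n"
  by (rule span_chi[OF subspace_Harm]) (auto intro: chi_in_Harm Harm_eq_0)

text \<open>For a homogeneous polynomial of degree \<open>d\<close> the coefficients at top sets of
  other lengths vanish anyway, so \<open>Harm_eq_0\<close> applies.\<close>

lemma span_chi_Harm_hom: "span (chi n ` Top_sets_len n d) = Harm_hom n d"
proof (rule span_chi[OF subspace_Harm_hom _ Top_sets_len_subset])
  show "chi n ` Top_sets_len n d \<subseteq> Harm_hom n d"
    using chi_in_Harm_hom Top_sets_lenD(4) by blast
  fix P assume P: "P \<in> Harm_hom n d"
    and zero: "\<And>B. B \<in> Top_sets_len n d \<Longrightarrow> Poly_Mapping.lookup P (mono_of (set B)) = 0"
  show "P = 0"
  proof (rule Harm_eq_0)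
    show "P \<in> Harm n" using P by (simp add: Harm_hom_def)
    fix B assume "B \<in> Top_sets n"
    then have B: "B \<in> Top_sets_len n (length B)" using Top_sets_iff by blast
    show "Poly_Mapping.lookup P (mono_of (set B)) = 0"
    proof (cases "length B = d")
      case True
      then show ?thesis using zero B by blast
    next
      case False
      have "mono_degree (mono_of (set B)) = length B"
        using Top_sets_lenD(4)[OF B] by (simp add: mono_degree_mono_of Seqs_def distinct_card)
      then have "mono_of (set B) \<notin> Poly_Mapping.keys P" using P False by (auto simp: Harm_hom_def)
      then show ?thesis by (simp add: in_keys_iff)
    qed
  qed
qed

section \<open>Orthogonality of the homogeneous parts\<close>

lemma poly_inner_commute: "poly_inner \<mu> f g = poly_inner \<mu> g f"
  by (simp add: poly_inner_def mult.commute)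

lemma subspace_orthogonal:
  assumes "exchangeable_measure n \<mu>" "g \<in> Harm n"
  shows "subspace {f \<in> Harm n. poly_inner \<mu> f g = 0}"
proof -
  have int: "integrable \<mu> (\<lambda>x. peval f x * peval g x)" if "f \<in> Harm n" for f
    using assms that by (simp add: exchangeable_measure_def)
  show ?thesis
    using subspace_Harm[of n] int
    by (auto simp: subspace_def poly_inner_def distrib_right mult.assoc Bochner_Integration.integral_add)
qed

text \<open>Minimality of the span is applied twice, first in the left argument and then, by
  symmetry of the form, in the right one.\<close>

lemma poly_inner_span_eq_0:
  assumes \<mu>: "exchangeable_measure n \<mu>" and XY: "X \<subseteq> Harm n" "Y \<subseteq> Harm n"
    and orth: "\<And>f g. f \<in> X \<Longrightarrow> g \<in> Y \<Longrightarrow> poly_inner \<mu> f g = 0"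
    and "f \<in> span X" "g \<in> span Y"
  shows "poly_inner \<mu> f g = 0"
proof -
  have "span X \<subseteq> {f \<in> Harm n. poly_inner \<mu> f g = 0}" if "g \<in> Y" for g
    using that XY orth by (intro span_minimal subspace_orthogonal[OF \<mu>]) auto
  then have "span Y \<subseteq> {g \<in> Harm n. poly_inner \<mu> g f = 0}"
    using assms(5) XY span_minimal[OF XY(1) subspace_Harm]
    by (intro span_minimal subspace_orthogonal[OF \<mu>]) (auto simp: poly_inner_commute[of \<mu> _ f])
  then show ?thesis using assms(6) by (auto simp: poly_inner_commute[of \<mu> f])
qed

theorem theorem3p1:
  fixes n :: nat
  assumes "n \<ge> 1"
  shows "(independent (chi n ` Top_sets n) \<and> span (chi n ` Top_sets n) = Harm n) \<and>
    (\<forall>d. 2 * d \<le> n \<longrightarrow>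
       independent (chi n ` Top_sets_len n d) \<and> span (chi n ` Top_sets_len n d) = Harm_hom n d) \<and>
    (\<forall>\<mu>. exchangeable_measure n \<mu> \<longrightarrow>
       (\<forall>B1\<in>Top_sets n. \<forall>B2\<in>Top_sets n. B1 \<noteq> B2 \<longrightarrow> poly_inner \<mu> (chi n B1) (chi n B2) = 0)) \<and>
    (\<forall>\<mu>. exchangeable_measure n \<mu> \<longrightarrow>
       (\<forall>d e. d \<noteq> e \<longrightarrow> (\<forall>f\<in>Harm_hom n d. \<forall>g\<in>Harm_hom n e. poly_inner \<mu> f g = 0)))"
proof (intro conjI allI impI ballI)
  show "independent (chi n ` Top_sets n)" by (rule independent_chi) simp
  show "independent (chi n ` Top_sets_len n d)" for d
    by (rule independent_chi[OF Top_sets_len_subset])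
  fix \<mu> assume \<mu>: "exchangeable_measure n \<mu>"
  show "poly_inner \<mu> (chi n B1) (chi n B2) = 0"
    if "B1 \<in> Top_sets n" "B2 \<in> Top_sets n" "B1 \<noteq> B2" for B1 B2
    by (rule exchangeable_measure_chi_orthogonal[OF \<mu> that])
  fix d e :: nat and f g assume "d \<noteq> e" "f \<in> Harm_hom n d" "g \<in> Harm_hom n e"
  \<comment> \<open>Spans reduce the claim to basis elements, which belong to top sets of different
    lengths and hence to different top sets.\<close>
  then have fg: "f \<in> span (chi n ` Top_sets_len n d)" "g \<in> span (chi n ` Top_sets_len n e)"
    by (simp_all add: span_chi_Harm_hom)
  show "poly_inner \<mu> f g = 0"
  proof (rule poly_inner_span_eq_0[OF \<mu> _ _ _ fg])
    show "chi n ` Top_sets_len n d \<subseteq> Harm n" "chi n ` Top_sets_len n e \<subseteq> Harm n"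
      using Top_sets_len_subset chi_in_Harm by blast+
    fix p q assume "p \<in> chi n ` Top_sets_len n d" "q \<in> chi n ` Top_sets_len n e"
    then obtain B1 B2 where B: "p = chi n B1" "q = chi n B2" "B1 \<in> Top_sets_len n d" "B2 \<in> Top_sets_len n e"
      by blast
    then have "B1 \<noteq> B2" using \<open>d \<noteq> e\<close> Top_sets_lenD(3) by blast
    then show "poly_inner \<mu> p q = 0"
      using B exchangeable_measure_chi_orthogonal[OF \<mu>] Top_sets_len_subset by blast
  qed
qed (simp_all add: span_chi_Harm span_chi_Harm_hom)

end
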